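(* Let $\mathcal{T}=\{T_j\mid j\in J\}$ be an a.d.f.s. family and let $G$ be a $\mathbb{T}(\mathcal{T})$-generic filter. Then in $V[G]$ the family $\mathcal{T}\cup\mathcal{S}_G$ is an a.d.f.s. family.
   Context: Trees: a tree is a nonempty $T\subseteq\omega^{<\omega}$ closed under initial segments; it is finitely splitting if every $s\in T$ has at least one and only finitely many immediate successors in $T$. $[T]=\{f\in\omega^\omega\mid \forall n\ f\restriction n\in T\}$. For $n<\omega$, a finitely splitting $n$-tree is a nonempty $T\subseteq\omega^{\le n}$ closed under initial segments such that every $s\in T$ of length $<n$ has at least one and only finitely many immediate successors in $T$. An a.d.f.s. family is a set $\mathcal{T}$ of finitely splitting trees such that $S\cap T$ is finite for all distinct $S,T\in\mathcal{T}$. For an a.d.f.s. family $\mathcal{T}$ let $\mathcal{W}(\mathcal{T})=\{f\in\omega^\omega\mid f\notin[T]\text{ for all }T\in\mathcal{T}\}$. $\mathbb{T}$ is the set of partial functions $p:\omega\times\omega^{<\omega}\to 2$ such that $\operatorname{dom}(p)=F_p\times\omega^{\le n_p}$ with $n_p\in\omega$, $F_p\subseteq\omega$ finite, and for all $i\in F_p$ the set $T^i_p=\{s\in\omega^{\le n_p}\mid p(i)(s)=1\}$ is a finitely splitting $n_p$-tree (here $p(i)(s)=p(i,s)$). Order: $p\le q$ iff $p\supseteq q$. $\mathbb{T}(\mathcal{T})$ is the set of pairs $(p,w_p)$ with $p\in\mathbb{T}$ and $w_p$ a function from a finite set $H_p\subseteq\mathcal{W}(\mathcal{T})$ to $\omega$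 such that for all $f\in H_p$: $w_p(f)\notin F_p$ or $f\restriction n_p\in T_p^{w_p(f)}$. Order: $(p,w_p)\le(q,w_q)$ iff $p\supseteq q$ and $w_p\supseteq w_q$. For a $\mathbb{T}(\mathcal{T})$-generic filter $G$, $\mathcal{S}_G=\{S_{G,i}\mid i\in\omega\}$ where $S_{G,i}=\{s\in\omega^{<\omega}\mid \exists (p,w_p)\in G\ \ p(i)(s)=1\}$. *)

theory Defs
  imports "HOL-Library.Countable_Set_Type"
begin

section \<open>Hereditarily countable sets\<close>

text \<open>
  Ground models are transitive models of ZFC consisting of hereditarily countable sets. This
  includes all countable transitive models. The type \<open>hc\<close> is the type of all hereditarily
  countable sets; membership \<open>x \<in> y\<close> is \<open>x \<in> elts y\<close>, and extensionality and foundation hold by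
  construction.
\<close>

datatype hc = HC "hc cset"

primrec elts :: "hc \<Rightarrow> hc set" where
  "elts (HC X) = rcset X"

text \<open>Only meaningful for countable \<open>X\<close>; \<open>set_of X\<close> is then the set with elements \<open>X\<close>.\<close>

definition set_of :: "hc set \<Rightarrow> hc" where
  "set_of X = HC (acset X)"

lemma elts_set_of: "countable X \<Longrightarrow> elts (set_of X) = X"
  by (simp add: set_of_def acset_inverse)

lemma countable_elts: "countable (elts x)"
  by (cases x) (use rcset in auto)

lemma set_of_elts: "set_of (elts x) = x"
  by (cases x) (simp add: set_of_def rcset_inverse)

definition mem_rel :: "(hc \<times> hc) set" where
  "mem_rel = {(x, y). x \<in> elts y}"

lemma wf_mem_rel: "wf mem_rel"
  unfolding wf_def
proof (intro allI impI)
  fix P :: "hc \<Rightarrow> bool" and x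
  assume step: "\<forall>x. (\<forall>y. (y, x) \<in> mem_rel \<longrightarrow> P y) \<longrightarrow> P x"
  show "P x"
  proof (induction x)
    case (HC X)
    have "P y" if "(y, HC X) \<in> mem_rel" for y
      using that HC by (auto simp: mem_rel_def cin.rep_eq)
    with step show ?case by blast
  qed
qed

definition opair :: "hc \<Rightarrow> hc \<Rightarrow> hc" where
  "opair x y = set_of {set_of {x}, set_of {x, y}}"

lemma opair_mem_rel:
  assumes "opair x y \<in> elts z"
  shows "(x, z) \<in> mem_rel\<^sup>+"
proof -
  have "(x, set_of {x}) \<in> mem_rel" "(set_of {x}, opair x y) \<in> mem_rel" "(opair x y, z) \<in> mem_rel"
    using assms by (simp_all add: mem_rel_def opair_def elts_set_of)
  then show ?thesis by (meson r_into_trancl' trancl_into_trancl)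
qed

definition succ :: "hc \<Rightarrow> hc" where
  "succ x = set_of (insert x (elts x))"

primrec num :: "nat \<Rightarrow> hc" where
  "num 0 = set_of {}"
| "num (Suc n) = succ (num n)"

definition dom_of :: "hc \<Rightarrow> hc set" where
  "dom_of f = {x. \<exists>y. opair x y \<in> elts f}"

definition ran_of :: "hc \<Rightarrow> hc set" where
  "ran_of f = {y. \<exists>x. opair x y \<in> elts f}"

definition is_func :: "hc \<Rightarrow> bool" where
  "is_func f \<longleftrightarrow> (\<forall>z\<in>elts f. \<exists>x y. z = opair x y) \<and>
     (\<forall>x y y'. opair x y \<in> elts f \<and> opair x y' \<in> elts f \<longrightarrow> y = y')"

definition restr :: "hc \<Rightarrow> nat \<Rightarrow> hc" where
  "restr f n = set_of {z \<in> elts f. \<exists>x\<in>elts (num n). \<exists>y. z = opair x y}"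


section \<open>Models of ZFC\<close>

text \<open>First-order formulas of set theory, with de Bruijn indices; \<open>Forall\<close> binds index 0.\<close>

datatype fm = Mem nat nat | Eq nat nat | Neg fm | Conj fm fm | Forall fm

primrec sat :: "hc set \<Rightarrow> (nat \<Rightarrow> hc) \<Rightarrow> fm \<Rightarrow> bool" where
  "sat M e (Mem i j) \<longleftrightarrow> e i \<in> elts (e j)"
| "sat M e (Eq i j) \<longleftrightarrow> e i = e j"
| "sat M e (Neg \<phi>) \<longleftrightarrow> \<not> sat M e \<phi>"
| "sat M e (Conj \<phi> \<psi>) \<longleftrightarrow> sat M e \<phi> \<and> sat M e \<psi>"
| "sat M e (Forall \<phi>) \<longleftrightarrow> (\<forall>x\<in>M. sat M (case_nat x e) \<phi>)"

text \<open>
  The axioms are relativized to the transitive class \<open>M\<close>. Elements of members of \<open>M\<close> are in \<open>M\<close>,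
  so quantifiers bounded by a member need no relativization, and extensionality and foundation
  hold automatically.
\<close>

definition transitive_model :: "hc set \<Rightarrow> bool" where
  "transitive_model M \<longleftrightarrow>
     (\<forall>x\<in>M. elts x \<subseteq> M) \<and>
     \<comment> \<open>Pairing\<close>
     (\<forall>x\<in>M. \<forall>y\<in>M. \<exists>z\<in>M. elts z = {x, y}) \<and>
     \<comment> \<open>Union\<close>
     (\<forall>x\<in>M. \<exists>z\<in>M. elts z = (\<Union>y\<in>elts x. elts y)) \<and>
     \<comment> \<open>Power set\<close>
     (\<forall>x\<in>M. \<exists>z\<in>M. elts z = {y \<in> M. elts y \<subseteq> elts x}) \<and>
     \<comment> \<open>Infinity\<close>
     (\<exists>z\<in>M. set_of {} \<in> elts z \<and> (\<forall>x\<in>elts z. succ x \<in> elts z)) \<and>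
     \<comment> \<open>Separation\<close>
     (\<forall>\<phi> e. range e \<subseteq> M \<longrightarrow>
        (\<forall>a\<in>M. \<exists>b\<in>M. elts b = {x \<in> elts a. sat M (case_nat x e) \<phi>})) \<and>
     \<comment> \<open>Replacement\<close>
     (\<forall>\<phi> e. range e \<subseteq> M \<longrightarrow>
        (\<forall>a\<in>M. (\<forall>x\<in>elts a. \<exists>!y. y \<in> M \<and> sat M (case_nat x (case_nat y e)) \<phi>) \<longrightarrow>
          (\<exists>b\<in>M. elts b = {y \<in> M. \<exists>x\<in>elts a. sat M (case_nat x (case_nat y e)) \<phi>}))) \<and>
     \<comment> \<open>Choice\<close>
     (\<forall>a\<in>M. (\<forall>x\<in>elts a. elts x \<noteq> {}) \<and>
        (\<forall>x\<in>elts a. \<forall>y\<in>elts a. x \<noteq> y \<longrightarrow> elts x \<inter> elts y = {}) \<longrightarrow>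
        (\<exists>c\<in>M. \<forall>x\<in>elts a. \<exists>!z. z \<in> elts x \<inter> elts c))"


section \<open>Generic extensions\<close>

definition filter_on :: "hc set \<Rightarrow> (hc \<Rightarrow> hc \<Rightarrow> bool) \<Rightarrow> hc set \<Rightarrow> bool" where
  "filter_on P le G \<longleftrightarrow> G \<subseteq> P \<and> G \<noteq> {} \<and>
     (\<forall>p\<in>G. \<forall>q\<in>P. le p q \<longrightarrow> q \<in> G) \<and>
     (\<forall>p\<in>G. \<forall>q\<in>G. \<exists>r\<in>G. le r p \<and> le r q)"

definition dense_in :: "hc set \<Rightarrow> (hc \<Rightarrow> hc \<Rightarrow> bool) \<Rightarrow> hc set \<Rightarrow> bool" where
  "dense_in P le D \<longleftrightarrow> D \<subseteq> P \<and> (\<forall>p\<in>P. \<exists>q\<in>D. le q p)"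

definition generic_filter :: "hc set \<Rightarrow> hc set \<Rightarrow> (hc \<Rightarrow> hc \<Rightarrow> bool) \<Rightarrow> hc set \<Rightarrow> bool" where
  "generic_filter M P le G \<longleftrightarrow>
     filter_on P le G \<and> (\<forall>D\<in>M. dense_in P le (elts D) \<longrightarrow> G \<inter> elts D \<noteq> {})"

inductive pname :: "hc set \<Rightarrow> hc \<Rightarrow> bool" for P where
  "(\<forall>z\<in>elts \<tau>. \<exists>\<sigma> p. z = opair \<sigma> p \<and> p \<in> P \<and> pname P \<sigma>) \<Longrightarrow> pname P \<tau>"

text \<open>\<open>nval G \<tau> = {nval G \<sigma> | \<exists>p\<in>G. (\<sigma>, p) \<in> \<tau>}\<close>\<close>

function nval :: "hc set \<Rightarrow> hc \<Rightarrow> hc" where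
  "nval G \<tau> = set_of (nval G ` {\<sigma>. \<exists>p\<in>G. opair \<sigma> p \<in> elts \<tau>})"
  by pat_completeness auto
termination
  by (relation "inv_image (mem_rel\<^sup>+) snd")
     (auto intro: wf_trancl wf_mem_rel wf_inv_image opair_mem_rel)

declare nval.simps [simp del]

definition generic_ext :: "hc set \<Rightarrow> hc set \<Rightarrow> hc set \<Rightarrow> hc set" where
  "generic_ext M P G = {nval G \<tau> | \<tau>. \<tau> \<in> M \<and> pname P \<tau>}"


section \<open>Trees and a.d.f.s. families, relativized to a class\<close>

text \<open>
  The argument \<open>A\<close> of a notion below is the transitive model in which it is evaluated: quantifiers
  over arbitrary sets range over \<open>A\<close>. Notions without such a quantifier (natural numbers, functions,
  finite sequences of natural numbers, trees) do not depend on the transitive model.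
\<close>

definition finite_in :: "hc set \<Rightarrow> hc set \<Rightarrow> bool" where
  "finite_in A X \<longleftrightarrow> (\<exists>n. \<exists>f\<in>A. is_func f \<and> dom_of f = elts (num n) \<and> ran_of f = X \<and>
     (\<forall>x x' y. opair x y \<in> elts f \<and> opair x' y \<in> elts f \<longrightarrow> x = x'))"

definition seqs :: "nat \<Rightarrow> hc set" where
  "seqs n = {s. is_func s \<and> dom_of s = elts (num n) \<and> ran_of s \<subseteq> range num}"

definition baire :: "hc set" where
  "baire = {f. is_func f \<and> dom_of f = range num \<and> ran_of f \<subseteq> range num}"

text \<open>Finite sequences are functions, so initial segments are subsets.\<close>

definition tree :: "hc set \<Rightarrow> bool" where
  "tree T \<longleftrightarrow> T \<noteq> {} \<and> T \<subseteq> (\<Union>n. seqs n) \<and>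
     (\<forall>s\<in>T. \<forall>t\<in>(\<Union>n. seqs n). elts t \<subseteq> elts s \<longrightarrow> t \<in> T)"

definition succs :: "hc set \<Rightarrow> hc \<Rightarrow> hc set" where
  "succs T s = {t \<in> T. elts s \<subseteq> elts t \<and> (\<exists>n. s \<in> seqs n \<and> t \<in> seqs (Suc n))}"

definition fs_tree :: "hc set \<Rightarrow> hc set \<Rightarrow> bool" where
  "fs_tree A T \<longleftrightarrow> tree T \<and> (\<forall>s\<in>T. succs T s \<noteq> {} \<and> finite_in A (succs T s))"

definition fs_ntree :: "hc set \<Rightarrow> nat \<Rightarrow> hc set \<Rightarrow> bool" where
  "fs_ntree A n T \<longleftrightarrow> tree T \<and> T \<subseteq> (\<Union>m\<le>n. seqs m) \<and>
     (\<forall>m<n. \<forall>s \<in> T \<inter> seqs m. succs T s \<noteq> {} \<and> finite_in A (succs T s))"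

definition branches :: "hc set \<Rightarrow> hc set" where
  "branches T = {f \<in> baire. \<forall>n. restr f n \<in> T}"

definition adfs :: "hc set \<Rightarrow> hc \<Rightarrow> bool" where
  "adfs A \<T> \<longleftrightarrow> (\<forall>T\<in>elts \<T>. fs_tree A (elts T)) \<and>
     (\<forall>S\<in>elts \<T>. \<forall>T\<in>elts \<T>. S \<noteq> T \<longrightarrow> finite_in A (elts S \<inter> elts T))"


section \<open>The forcing\<close>

definition W_reals :: "hc set \<Rightarrow> hc \<Rightarrow> hc set" where
  "W_reals A \<T> = {f \<in> A \<inter> baire. \<forall>T\<in>elts \<T>. f \<notin> branches (elts T)}"

definition cond_tree :: "hc \<Rightarrow> hc \<Rightarrow> hc set" where
  "cond_tree p i = {s. opair (opair i s) (num 1) \<in> elts p}"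

text \<open>
  \<open>p\<close> belongs to the forcing without side conditions, with \<open>F\<^sub>p = F\<close> and \<open>n\<^sub>p = n\<close>. If \<open>p\<close> is empty
  then \<open>F\<close> is empty and \<open>n\<close> is arbitrary; in that case \<open>n\<close> plays no role below.
\<close>

definition tree_cond :: "hc set \<Rightarrow> hc set \<Rightarrow> nat \<Rightarrow> hc \<Rightarrow> bool" where
  "tree_cond A F n p \<longleftrightarrow> p \<in> A \<and> F \<subseteq> range num \<and> finite_in A F \<and>
     is_func p \<and> ran_of p \<subseteq> {num 0, num 1} \<and>
     dom_of p = {opair i s | i s. i \<in> F \<and> s \<in> (\<Union>m\<le>n. seqs m)} \<and>
     (\<forall>i\<in>F. fs_ntree A n (cond_tree p i))"

definition side_cond :: "hc set \<Rightarrow> hc \<Rightarrow> hc \<Rightarrow> bool" where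
  "side_cond A \<T> w \<longleftrightarrow> w \<in> A \<and> is_func w \<and> dom_of w \<subseteq> W_reals A \<T> \<and> finite_in A (dom_of w) \<and>
     ran_of w \<subseteq> range num"

definition tree_forcing :: "hc set \<Rightarrow> hc \<Rightarrow> hc set" where
  "tree_forcing A \<T> = {opair p w | p w. \<exists>F n. tree_cond A F n p \<and> side_cond A \<T> w \<and>
     (\<forall>f i. opair f i \<in> elts w \<longrightarrow> i \<notin> F \<or> restr f n \<in> cond_tree p i)}"

definition forcing_le :: "hc \<Rightarrow> hc \<Rightarrow> bool" where
  "forcing_le c d \<longleftrightarrow> (\<exists>p w q v. c = opair p w \<and> d = opair q v \<and>
     elts q \<subseteq> elts p \<and> elts v \<subseteq> elts w)"

definition generic_tree :: "hc set \<Rightarrow> nat \<Rightarrow> hc" where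
  "generic_tree G i = set_of {s \<in> (\<Union>n. seqs n). \<exists>p w. opair p w \<in> G \<and> s \<in> cond_tree p (num i)}"

definition generic_trees :: "hc set \<Rightarrow> hc set" where
  "generic_trees G = range (generic_tree G)"

end

theory Submission
  imports Defs
begin

text \<open>
  A condition is a finite approximation to the generic trees: finitely many trees of a common
  finite height \<open>n\<close>, together with finitely many promises that a real \<open>f\<close> is a branch of the tree
  with number \<open>w f\<close>. A condition can be prolonged by one level (\<open>cond_grow\<close>): each top node of the
  \<open>i\<close>-th tree receives one new successor with label \<open>K + i\<close>, and the promised branches are
  continued. The number \<open>K\<close> is free, and this freedom gives almost disjointness.

  \<^item> Let \<open>T\<close> be a tree of the ground model family. The promised reals are not branches of \<open>T\<close>, so
  they have left \<open>T\<close> at some height. Above that height choose \<open>K\<close> larger than all labels on the next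
  level of \<open>T\<close>, which is finite as \<open>T\<close> is finitely splitting. Then the new level of the \<open>i\<close>-th tree
  misses \<open>T\<close> (\<open>cond_avoid_tree\<close>).
  \<^item> Let \<open>i \<noteq> j\<close>. A real is promised to at most one tree, so the reals promised to \<open>i\<close> and to \<open>j\<close> are
  different and have separated at some height. Above it choose \<open>K\<close> larger than the values of these
  reals; the labels \<open>K + i\<close> and \<open>K + j\<close> differ, so the new levels of the two trees are disjoint
  (\<open>cond_separate\<close>).

  In both cases two trees have no common node of a certain height, hence, being closed under initial
  segments, none above it, and the intersection is finite. By genericity the filter contains such
  conditions. It also contains, for all \<open>i\<close> and \<open>m\<close>, a condition that has an \<open>i\<close>-th tree of height
  at least \<open>m\<close>; compatibility of the conditions in the filter shows that this tree is exactly the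
  part of the generic tree up to its height (\<open>gtree_below\<close>). So the generic tree is finitely splitting.

  Genericity only concerns dense sets that are members of the model \<open>V\<close>, and the extension consists
  of the values of names in \<open>V\<close>. It must therefore be shown that the forcing, the three kinds of dense
  sets and the name of the family belong to \<open>V\<close>. Most of the text serves this purpose: the first part
  is a calculus of predicates, terms and classes definable over \<open>V\<close>, whose closure rules follow the
  structure of the defining formulas, so that a definability proof only collects rules. Separation and
  replacement then put the sets in question into \<open>V\<close> (\<open>coded_tree_forcing\<close>, \<open>family_in_VG\<close>).
  Check names (\<open>check_name_V\<close>) yield \<open>V \<subseteq> V[G]\<close>. Since all finite sets involved are finite sets
  of finite sequences, their enumerations are already in \<open>V\<close> (\<open>finite_in_iff\<close>).
\<close>

section \<open>Definability over a transitive model\<close>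

lemma elts_eq_iff: "elts x = elts y \<longleftrightarrow> x = y"
  by (metis set_of_elts)

text \<open>
  The context left by stripping the variable with index 0: a predicate \<open>Q x e\<close> under a quantifier over \<open>x\<close>
  is represented as \<open>Q (e 0) (tl_env e)\<close>.
\<close>

definition tl_env :: "(nat \<Rightarrow> hc) \<Rightarrow> nat \<Rightarrow> hc" where
  "tl_env e = (\<lambda>i. e (Suc i))"

lemma tl_env_case_nat [simp]: "tl_env (case_nat x e) = e"
  by (simp add: tl_env_def)

primrec rename_fm :: "(nat \<Rightarrow> nat) \<Rightarrow> fm \<Rightarrow> fm" where
  "rename_fm \<rho> (Mem i j) = Mem (\<rho> i) (\<rho> j)"
| "rename_fm \<rho> (Eq i j) = Eq (\<rho> i) (\<rho> j)"
| "rename_fm \<rho> (Neg \<phi>) = Neg (rename_fm \<rho> \<phi>)"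
| "rename_fm \<rho> (Conj \<phi> \<psi>) = Conj (rename_fm \<rho> \<phi>) (rename_fm \<rho> \<psi>)"
| "rename_fm \<rho> (Forall \<phi>) = Forall (rename_fm (case_nat 0 (\<lambda>i. Suc (\<rho> i))) \<phi>)"

lemma sat_rename_fm: "sat M e (rename_fm \<rho> \<phi>) \<longleftrightarrow> sat M (\<lambda>i. e (\<rho> i)) \<phi>"
proof (induction \<phi> arbitrary: e \<rho>)
  case (Forall \<phi>)
  have "(\<lambda>i. case_nat x e (case_nat 0 (\<lambda>i. Suc (\<rho> i)) i)) = case_nat x (\<lambda>i. e (\<rho> i))" for x
    by (rule ext) (simp split: nat.split)
  then show ?case using Forall by simp
qed simp_all

text \<open>
  Variables occupy the even indices and parameters the odd ones. Both supplies are infinite, so a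
  formula may use any number of either, and two parameter sequences merge into one by \<open>join\<close> again.
\<close>

definition join :: "(nat \<Rightarrow> hc) \<Rightarrow> (nat \<Rightarrow> hc) \<Rightarrow> nat \<Rightarrow> hc" where
  "join e q = (\<lambda>i. if even i then e (i div 2) else q (i div 2))"

text \<open>
  Quantification introduces a variable in front of the joined environment, but it has to be the first
  one of the even half; the renaming moves it there.
\<close>

lemma sat_case_join:
  "sat M (case_nat x (join e q)) (rename_fm (\<lambda>i. if even i then (if i = 0 then 0 else i - 1) else Suc i) \<phi>)
    \<longleftrightarrow> sat M (join (case_nat x e) q) \<phi>"
proof -
  have "(\<lambda>i. case_nat x (join e q) (if even i then (if i = 0 then 0 else i - 1) else Suc i))
      = join (case_nat x e) q"
  proof
    fix i show "case_nat x (join e q) (if even i then (if i = 0 then 0 else i - 1) else Suc i)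
      = join (case_nat x e) q i"
    proof (cases "even i")
      case True
      then obtain k where "i = 2 * k" by blast
      then show ?thesis by (cases k) (auto simp: join_def)
    next
      case False
      then show ?thesis by (auto simp: join_def)
    qed
  qed
  then show ?thesis by (simp only: sat_rename_fm)
qed

locale zf_model =
  fixes V :: "hc set"
  assumes model: "transitive_model V"
begin

definition env :: "(nat \<Rightarrow> hc) \<Rightarrow> bool" where
  "env e \<longleftrightarrow> (\<forall>i. e i \<in> V)"

lemma env_app [simp, intro]: "env e \<Longrightarrow> e i \<in> V"
  by (simp add: env_def)

lemma env_tl_env [simp, intro]: "env e \<Longrightarrow> env (tl_env e)"
  by (simp add: env_def tl_env_def)

lemma env_case [simp, intro]: "x \<in> V \<Longrightarrow> env e \<Longrightarrow> env (case_nat x e)"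
  by (simp add: env_def split: nat.split)

lemma env_join: "env e \<Longrightarrow> env q \<Longrightarrow> env (join e q)"
  by (simp add: env_def join_def)

text \<open>
  Definability with parameters from \<open>V\<close>. A predicate takes a whole environment, so that the closure
  rules below apply to bodies of quantifiers without any bookkeeping of free variables.
\<close>

definition definable :: "((nat \<Rightarrow> hc) \<Rightarrow> bool) \<Rightarrow> bool" where
  "definable Q \<longleftrightarrow> (\<exists>\<phi> q. env q \<and> (\<forall>e. env e \<longrightarrow> Q e = sat V (join e q) \<phi>))"

lemma definable_cong: "(\<And>e. env e \<Longrightarrow> Q e = Q' e) \<Longrightarrow> definable Q' \<Longrightarrow> definable Q"
  by (simp add: definable_def)

lemma definable_not: "definable Q \<Longrightarrow> definable (\<lambda>e. \<not> Q e)"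
  unfolding definable_def by (metis sat.simps(3))

lemma definable_conj:
  assumes "definable Q" "definable R" shows "definable (\<lambda>e. Q e \<and> R e)"
proof -
  obtain \<phi> q where q: "env q" "\<And>e. env e \<Longrightarrow> Q e = sat V (join e q) \<phi>"
    using assms(1) by (auto simp: definable_def)
  obtain \<psi> r where r: "env r" "\<And>e. env e \<Longrightarrow> R e = sat V (join e r) \<psi>"
    using assms(2) by (auto simp: definable_def)
  \<comment> \<open>The two parameter sequences are joined, so parameter \<open>k\<close> moves from index \<open>2 * k + 1\<close> to
    \<open>2 * (2 * k) + 1\<close> for \<open>Q\<close> and to \<open>2 * (2 * k + 1) + 1\<close> for \<open>R\<close>.\<close>
  let ?f = "\<lambda>i. if even i then i else 2 * i - 1"
  let ?g = "\<lambda>i. if even i then i else 2 * i + 1"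
  have f: "(\<lambda>i. join e (join q r) (?f i)) = join e q"
    and g: "(\<lambda>i. join e (join q r) (?g i)) = join e r" for e
  proof -
    have "join e (join q r) (?f i) = join e q i \<and> join e (join q r) (?g i) = join e r i" for i
    proof (cases "even i")
      case False
      then obtain k where "i = 2 * k + 1" by (rule oddE)
      then have "?f i = 2 * (2 * k) + 1" "?g i = 2 * (2 * k + 1) + 1" "i = 2 * k + 1" by simp_all
      then show ?thesis unfolding join_def by simp
    qed (simp add: join_def)
    then show "(\<lambda>i. join e (join q r) (?f i)) = join e q"
      "(\<lambda>i. join e (join q r) (?g i)) = join e r" by blast+
  qed
  have "(Q e \<and> R e) = sat V (join e (join q r)) (Conj (rename_fm ?f \<phi>) (rename_fm ?g \<psi>))" if "env e" for e
    unfolding sat.simps sat_rename_fm f g using q r that by simp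
  then show ?thesis unfolding definable_def using env_join[OF q(1) r(1)] by blast
qed

lemma definable_allV:
  assumes "definable (\<lambda>e. Q (e 0) (tl_env e))"
  shows "definable (\<lambda>e. \<forall>x\<in>V. Q x e)"
proof -
  obtain \<phi> q where q: "env q" "\<And>e. env e \<Longrightarrow> Q (e 0) (tl_env e) = sat V (join e q) \<phi>"
    using assms by (auto simp: definable_def)
  let ?\<phi> = "Forall (rename_fm (\<lambda>i. if even i then (if i = 0 then 0 else i - 1) else Suc i) \<phi>)"
  have "(\<forall>x\<in>V. Q x e) = sat V (join e q) ?\<phi>" if "env e" for e
  proof -
    have "Q x e = sat V (join (case_nat x e) q) \<phi>" if "x \<in> V" for x
      using q(2)[of "case_nat x e"] that \<open>env e\<close> by simp
    then show ?thesis by (simp add: sat_case_join)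
  qed
  then show ?thesis unfolding definable_def using q(1) by blast
qed

lemma definable_disj: "definable Q \<Longrightarrow> definable R \<Longrightarrow> definable (\<lambda>e. Q e \<or> R e)"
  using definable_not[OF definable_conj[OF definable_not definable_not], of Q R] by simp

lemma definable_imp: "definable Q \<Longrightarrow> definable R \<Longrightarrow> definable (\<lambda>e. Q e \<longrightarrow> R e)"
  using definable_disj[OF definable_not, of Q R] by simp

lemma definable_iff: "definable Q \<Longrightarrow> definable R \<Longrightarrow> definable (\<lambda>e. Q e \<longleftrightarrow> R e)"
  using definable_conj[OF definable_imp[of Q R] definable_imp[of R Q]] by (simp only: iff_conv_conj_imp)

lemma definable_exV: "definable (\<lambda>e. Q (e 0) (tl_env e)) \<Longrightarrow> definable (\<lambda>e. \<exists>x\<in>V. Q x e)"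
  using definable_not[OF definable_allV[OF definable_not], of Q] by simp

lemma ex_env: "\<exists>e. env e"
  using model unfolding transitive_model_def env_def by (meson ex_in_conv)

lemma definable_mem_var: "definable (\<lambda>e. e i \<in> elts (e j))"
proof -
  obtain q where "env q" using ex_env by blast
  moreover have "(e i \<in> elts (e j)) = sat V (join e q) (Mem (2 * i) (2 * j))" for e
    by (simp add: join_def)
  ultimately show ?thesis unfolding definable_def by blast
qed

lemma definable_eq_var: "definable (\<lambda>e. e i = e j)"
proof -
  obtain q where "env q"
    using model unfolding transitive_model_def env_def by (meson ex_in_conv)
  moreover have "(e i = e j) = sat V (join e q) (Eq (2 * i) (2 * j))" for e
    by (simp add: join_def)
  ultimately show ?thesis unfolding definable_def by blast
qed

lemma definable_eq_const: 
  assumes "c \<in> V" shows "definable (\<lambda>e. e i = c)"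
proof -
  have "(e i = c) = sat V (join e (\<lambda>_. c)) (Eq (2 * i) 1)" for e
    by (simp add: join_def)
  moreover have "env (\<lambda>_. c)" using assms by (simp add: env_def)
  ultimately show ?thesis unfolding definable_def by blast
qed

lemma definable_True: "definable (\<lambda>e. True)"
  using definable_eq_var[of 0 0] by simp

lemma definable_False: "definable (\<lambda>e. False)"
  using definable_not[OF definable_True] by simp

lemma definable_reindex:
  assumes "definable Q" shows "definable (\<lambda>e. Q (\<lambda>i. e (\<rho> i)))"
proof -
  obtain \<phi> q where q: "env q" "\<And>e. env e \<Longrightarrow> Q e = sat V (join e q) \<phi>"
    using assms by (auto simp: definable_def)
  let ?f = "\<lambda>i. if even i then 2 * \<rho> (i div 2) else i"
  have "Q (\<lambda>i. e (\<rho> i)) = sat V (join e q) (rename_fm ?f \<phi>)" if "env e" for e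
  proof -
    have "(\<lambda>i. join e q (?f i)) = join (\<lambda>i. e (\<rho> i)) q"
      by (rule ext) (auto simp: join_def)
    moreover have "env (\<lambda>i. e (\<rho> i))" using that by (simp add: env_def)
    ultimately show ?thesis by (simp add: sat_rename_fm q(2))
  qed
  then show ?thesis unfolding definable_def using q(1) by blast
qed

lemma definable_tl_env: "definable Q \<Longrightarrow> definable (\<lambda>e. Q (tl_env e))"
  unfolding tl_env_def by (rule definable_reindex)

text \<open>
  Definable operations on \<open>V\<close>. They serve as terms: by \<open>definable_subst\<close> they may be substituted for
  variables in definable predicates.
\<close>

definition defterm :: "((nat \<Rightarrow> hc) \<Rightarrow> hc) \<Rightarrow> bool" where
  "defterm t \<longleftrightarrow> (\<forall>e. env e \<longrightarrow> t e \<in> V) \<and> definable (\<lambda>e. e 0 = t (tl_env e))"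

lemma defterm_V: "defterm t \<Longrightarrow> env e \<Longrightarrow> t e \<in> V"
  by (simp add: defterm_def)

lemma defterm_var: "defterm (\<lambda>e. e i)"
  using definable_eq_var[of 0 "Suc i"] by (simp add: defterm_def tl_env_def)

lemma defterm_const: "c \<in> V \<Longrightarrow> defterm (\<lambda>e. c)"
  by (simp add: defterm_def definable_eq_const)

lemma defterm_tl_env: 
  assumes "defterm t" shows "defterm (\<lambda>e. t (tl_env e))"
proof -
  have "definable (\<lambda>e. e 0 = t (tl_env e))" using assms by (simp add: defterm_def)
  from definable_reindex[OF this, of "case_nat 0 (\<lambda>i. Suc (Suc i))"]
  show ?thesis using assms by (simp add: defterm_def tl_env_def env_def)
qed

lemma definable_subst:
  assumes "defterm t" "definable (\<lambda>e. Q (e 0) (tl_env e))" shows "definable (\<lambda>e. Q (t e) e)"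
proof -
  have "definable (\<lambda>e. \<exists>x\<in>V. x = t e \<and> Q x e)"
    using assms by (intro definable_exV definable_conj) (simp_all add: defterm_def)
  then show ?thesis
    by (rule definable_cong[rotated]) (use assms(1) defterm_V in auto)
qed

lemma definable_mem:
  assumes "defterm t" "defterm s" shows "definable (\<lambda>e. t e \<in> elts (s e))"
proof (rule definable_subst[OF assms(1)])
  show "definable (\<lambda>e. e 0 \<in> elts (s (tl_env e)))"
    by (rule definable_subst[OF defterm_tl_env[OF assms(2)]]) (simp add: tl_env_def definable_mem_var)
qed

lemma definable_eq:
  assumes "defterm t" "defterm s" shows "definable (\<lambda>e. t e = s e)"
proof (rule definable_subst[OF assms(1)])
  show "definable (\<lambda>e. e 0 = s (tl_env e))" using assms(2) by (simp add: defterm_def)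
qed

text \<open>
  Definable families of classes. A definition that speaks of sets, such as that of a finitely
  splitting tree, is handled for arbitrary definable classes, whether or not the sets are in \<open>V\<close>.
\<close>

definition defclass :: "((nat \<Rightarrow> hc) \<Rightarrow> hc set) \<Rightarrow> bool" where
  "defclass X \<longleftrightarrow> (\<forall>e. env e \<longrightarrow> X e \<subseteq> V) \<and> definable (\<lambda>e. e 0 \<in> X (tl_env e))"

lemma defclass_subset_V: "defclass X \<Longrightarrow> env e \<Longrightarrow> x \<in> X e \<Longrightarrow> x \<in> V"
  by (auto simp: defclass_def)

lemma defclass_tl_env: 
  assumes "defclass X" shows "defclass (\<lambda>e. X (tl_env e))"
proof -
  have "definable (\<lambda>e. e 0 \<in> X (tl_env e))" using assms by (simp add: defclass_def)
  from definable_reindex[OF this, of "case_nat 0 (\<lambda>i. Suc (Suc i))"]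
  show ?thesis using assms by (simp add: defclass_def tl_env_def[abs_def] env_def)
qed

lemma definable_in:
  assumes "defterm t" "defclass X" shows "definable (\<lambda>e. t e \<in> X e)"
  by (rule definable_subst[OF assms(1)]) (use assms(2) in \<open>simp add: defclass_def\<close>)

lemma trans_V: "x \<in> elts y \<Longrightarrow> y \<in> V \<Longrightarrow> x \<in> V"
  using model[unfolded transitive_model_def, THEN conjunct1] by blast

lemma defclass_elts: "defterm t \<Longrightarrow> defclass (\<lambda>e. elts (t e))"
  unfolding defclass_def by (intro conjI allI impI subsetI definable_mem defterm_tl_env defterm_var) (blast intro: trans_V defterm_V)

lemma defclass_Collect:
  assumes "\<And>e x. env e \<Longrightarrow> Q x e \<Longrightarrow> x \<in> V" "definable (\<lambda>e. Q (e 0) (tl_env e))"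
  shows "defclass (\<lambda>e. {x. Q x e})"
  using assms unfolding defclass_def by auto

text \<open>
  Quantifiers over all hereditarily countable sets are harmless when the matrix is trivial outside \<open>V\<close>.
  This is the case for the quantifiers in the definitions of functions, domains and ranges, as \<open>V\<close> is
  transitive.
\<close>

lemma definable_all:
  assumes "\<And>e x. env e \<Longrightarrow> x \<notin> V \<Longrightarrow> Q x e" "definable (\<lambda>e. Q (e 0) (tl_env e))"
  shows "definable (\<lambda>e. \<forall>x. Q x e)"
  by (rule definable_cong[OF _ definable_allV[OF assms(2)]]) (use assms(1) in blast)

text \<open>
  The dual of \<open>definable_all\<close>: witnesses are automatically in \<open>V\<close>.
\<close>

lemma definable_ex:
  assumes "\<And>e x. env e \<Longrightarrow> Q x e \<Longrightarrow> x \<in> V" "definable (\<lambda>e. Q (e 0) (tl_env e))"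
  shows "definable (\<lambda>e. \<exists>x. Q x e)"
  by (rule definable_cong[OF _ definable_exV[OF assms(2)]]) (use assms(1) in blast)

lemma definable_ball:
  assumes "defclass X" "definable (\<lambda>e. Q (e 0) (tl_env e))"
  shows "definable (\<lambda>e. \<forall>x\<in>X e. Q x e)"
  unfolding Ball_def
  by (rule definable_all) (use defclass_subset_V[OF assms(1)] in blast, intro definable_imp definable_in defterm_var defclass_tl_env assms)

lemma definable_bex:
  assumes "defclass X" "definable (\<lambda>e. Q (e 0) (tl_env e))"
  shows "definable (\<lambda>e. \<exists>x\<in>X e. Q x e)"
  unfolding Bex_def
  by (rule definable_ex) (use defclass_subset_V[OF assms(1)] in blast, intro definable_conj definable_in defterm_var defclass_tl_env assms)

lemma definable_subset: "defclass X \<Longrightarrow> defclass Y \<Longrightarrow> definable (\<lambda>e. X e \<subseteq> Y e)"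
  unfolding subset_eq by (intro definable_ball definable_in defterm_var defclass_tl_env)

lemma definable_set_eq: "defclass X \<Longrightarrow> defclass Y \<Longrightarrow> definable (\<lambda>e. X e = Y e)"
  unfolding set_eq_subset by (intro definable_conj definable_subset)

lemma defclass_empty: "defclass (\<lambda>e. {})"
  by (simp add: defclass_def definable_False)

lemma defclass_Un: 
  assumes "defclass X" "defclass Y" shows "defclass (\<lambda>e. X e \<union> Y e)"
  using assms definable_disj[of "\<lambda>e. e 0 \<in> X (tl_env e)" "\<lambda>e. e 0 \<in> Y (tl_env e)"] by (simp add: defclass_def)

lemma defclass_Int:
  assumes "defclass X" "defclass Y" shows "defclass (\<lambda>e. X e \<inter> Y e)"
  using assms definable_conj[of "\<lambda>e. e 0 \<in> X (tl_env e)" "\<lambda>e. e 0 \<in> Y (tl_env e)"] by (auto simp add: defclass_def)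

lemma defclass_Diff: 
  assumes "defclass X" "defclass Y" shows "defclass (\<lambda>e. X e - Y e)"
  using assms definable_conj[of "\<lambda>e. e 0 \<in> X (tl_env e)" "\<lambda>e. \<not> e 0 \<in> Y (tl_env e)"] definable_not[of "\<lambda>e. e 0 \<in> Y (tl_env e)"]
  by (auto simp add: defclass_def)

lemma defclass_insert: 
  assumes "defterm t" "defclass X" shows "defclass (\<lambda>e. insert (t e) (X e))"
  using assms definable_disj[of "\<lambda>e. e 0 = t (tl_env e)" "\<lambda>e. e 0 \<in> X (tl_env e)"]
  by (simp add: defclass_def defterm_def)

section \<open>Sets that belong to the model\<close>

definition coded :: "hc set \<Rightarrow> bool" where
  "coded X \<longleftrightarrow> (\<exists>b\<in>V. elts b = X)"

lemma coded_elts [simp]: "b \<in> V \<Longrightarrow> coded (elts b)"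
  by (auto simp: coded_def)

lemma coded_set_of: "coded X \<Longrightarrow> set_of X \<in> V" and coded_elts_set_of: "coded X \<Longrightarrow> elts (set_of X) = X"
  and coded_countable: "coded X \<Longrightarrow> countable X"
  by (auto simp: coded_def set_of_elts countable_elts)

lemma coded_V: "coded X \<Longrightarrow> X \<subseteq> V"
  by (auto simp: coded_def intro: trans_V)

lemma defterm_set_of:
  assumes "defclass X" "\<And>e. env e \<Longrightarrow> coded (X e)"
  shows "defterm (\<lambda>e. set_of (X e))"
  unfolding defterm_def
proof (intro conjI allI impI)
  have "definable (\<lambda>e. elts (e 0) = X (tl_env e))"
    by (intro definable_set_eq defclass_elts defterm_var defclass_tl_env assms)
  then show "definable (\<lambda>e. e 0 = set_of (X (tl_env e)))"
  proof (rule definable_cong[rotated])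
    fix e assume "env e"
    then have *: "elts (set_of (X (tl_env e))) = X (tl_env e)" using assms(2) coded_elts_set_of by blast
    show "(e 0 = set_of (X (tl_env e))) = (elts (e 0) = X (tl_env e))"
      by (subst *[symmetric]) (simp add: elts_eq_iff)
  qed
  fix e assume "env e" then show "set_of (X e) \<in> V" using assms(2) coded_set_of by blast
qed

lemma separation_defclass:
  assumes "defclass X" "env e" "X e \<subseteq> Y" "coded Y"
  shows "coded (X e)"
proof -
  obtain a where a: "a \<in> V" "elts a = Y" using assms by (auto simp: coded_def)
  obtain \<phi> q where q: "env q" "\<And>e. env e \<Longrightarrow> (e 0 \<in> X (tl_env e)) = sat V (join e q) \<phi>"
    using assms(1) by (auto simp: defclass_def definable_def)
  let ?\<phi> = "rename_fm (\<lambda>i. if even i then (if i = 0 then 0 else i - 1) else Suc i) \<phi>"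
  have "range (join e q) \<subseteq> V" using env_join[OF assms(2) q(1)] by (auto simp: env_def)
  moreover have "\<forall>\<phi> e. range e \<subseteq> V \<longrightarrow> (\<forall>a\<in>V. \<exists>b\<in>V. elts b = {x \<in> elts a. sat V (case_nat x e) \<phi>})"
    using model unfolding transitive_model_def by (elim conjE) assumption
  ultimately obtain b where "b \<in> V" "elts b = {x \<in> elts a. sat V (case_nat x (join e q)) ?\<phi>}"
    using a(1) by meson
  moreover have "sat V (case_nat x (join e q)) ?\<phi> \<longleftrightarrow> x \<in> X e" if "x \<in> elts a" for x
    using q(2)[of "case_nat x e"] that assms(2) trans_V[OF that a(1)] by (simp add: sat_case_join)
  ultimately show ?thesis using assms(3) a(2) unfolding coded_def by auto
qed

lemma separation:
  assumes "coded Y" "definable (\<lambda>e. R (e 0))" shows "coded {x \<in> Y. R x}"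
proof -
  obtain e where e: "env e" using ex_env by blast
  have "defclass (\<lambda>e. {x \<in> Y. R x})" 
  proof (rule defclass_Collect)
    obtain a where a: "a \<in> V" "elts a = Y" using assms by (auto simp: coded_def)
    show "definable (\<lambda>e. e 0 \<in> Y \<and> R (e 0))"
      unfolding a(2)[symmetric] by (intro definable_conj definable_mem defterm_var defterm_const a(1) assms(2))
  qed (use coded_V[OF assms(1)] in blast)
  from separation_defclass[OF this e _ assms(1)] show ?thesis by auto
qed

text \<open>
  Only the values on \<open>A\<close> matter; in this form \<open>f\<close> may be given by a formula that is functional on
  \<open>A\<close> alone.
\<close>

lemma replacement:
  assumes "coded A" "\<And>x. x \<in> A \<Longrightarrow> f x \<in> V" "definable (\<lambda>e. Q (e 0) (e 1))"
    "\<And>x y. x \<in> A \<Longrightarrow> y \<in> V \<Longrightarrow> Q x y \<longleftrightarrow> y = f x"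
  shows "coded (f ` A)"
proof -
  obtain a where a: "a \<in> V" "elts a = A" using assms by (auto simp: coded_def)
  obtain \<phi> q where q: "env q" "\<And>e. env e \<Longrightarrow> Q (e 0) (e 1) = sat V (join e q) \<phi>"
    using assms(3) by (auto simp: definable_def)
  \<comment> \<open>The two variables in front become the first two even indices; all other indices shift by 2.\<close>
  let ?\<rho> = "\<lambda>i. if even i then (if i = 0 then 0 else if i = 2 then 1 else i - 2) else i + 2"
  have "(\<lambda>i. case_nat x (case_nat y (join q q)) (?\<rho> i)) = join (case_nat x (case_nat y q)) q" for x y
  proof
    fix i show "case_nat x (case_nat y (join q q)) (?\<rho> i) = join (case_nat x (case_nat y q)) q i"
    proof (cases "even i")
      case True
      then obtain k where "i = 2 * k" by blast
      then show ?thesis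
        by (cases k; cases "k - 1") (auto simp: join_def)
    qed (auto simp: join_def)
  qed
  then have *: "sat V (case_nat x (case_nat y (join q q))) (rename_fm ?\<rho> \<phi>) \<longleftrightarrow> y = f x"
    if "x \<in> A" "y \<in> V" for x y
    using q(2)[of "case_nat x (case_nat y q)"] coded_V[OF assms(1)] that q(1) assms(4)
    by (auto simp: sat_rename_fm)
  have "range (join q q) \<subseteq> V" using env_join[OF q(1) q(1)] by (auto simp: env_def)
  moreover have "\<forall>\<phi> e. range e \<subseteq> V \<longrightarrow>
        (\<forall>a\<in>V. (\<forall>x\<in>elts a. \<exists>!y. y \<in> V \<and> sat V (case_nat x (case_nat y e)) \<phi>) \<longrightarrow>
          (\<exists>b\<in>V. elts b = {y \<in> V. \<exists>x\<in>elts a. sat V (case_nat x (case_nat y e)) \<phi>}))"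
    using model unfolding transitive_model_def by (elim conjE) assumption
  moreover have "\<forall>x\<in>elts a. \<exists>!y. y \<in> V \<and> sat V (case_nat x (case_nat y (join q q))) (rename_fm ?\<rho> \<phi>)"
    using * assms(2) a(2) by auto
  ultimately obtain b where "b \<in> V"
    "elts b = {y \<in> V. \<exists>x\<in>elts a. sat V (case_nat x (case_nat y (join q q))) (rename_fm ?\<rho> \<phi>)}"
    using a(1) by meson
  moreover have "\<dots> = f ` A" using * assms(2) a(2) by auto
  ultimately show ?thesis unfolding coded_def by auto
qed

end

section \<open>Pairs, numbers and products\<close>

lemma set_of_eq_iff: "countable X \<Longrightarrow> countable Y \<Longrightarrow> set_of X = set_of Y \<longleftrightarrow> X = Y"
  by (metis elts_set_of)

lemma opair_eq_iff [simp]: "opair x y = opair x' y' \<longleftrightarrow> x = x' \<and> y = y'"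
  unfolding opair_def by (auto simp: set_of_eq_iff doubleton_eq_iff)

lemma elts_opair: "elts (opair x y) = {set_of {x}, set_of {x, y}}"
  by (simp add: opair_def elts_set_of)

lemma elts_succ: "elts (succ x) = insert x (elts x)"
  by (simp add: succ_def elts_set_of countable_elts)

lemma elts_num: "elts (num n) = num ` {..<n}"
  by (induction n) (auto simp: elts_set_of elts_succ lessThan_Suc)

lemma elts_irrefl: "x \<notin> elts x"
  using wf_mem_rel by (auto simp: mem_rel_def dest: wf_not_refl)

lemma elts_asym: "x \<in> elts y \<Longrightarrow> y \<notin> elts x"
  using wf_not_sym[OF wf_mem_rel] by (auto simp: mem_rel_def)

lemma num_neq: "m < n \<Longrightarrow> num m \<noteq> num n"
  using elts_num[of n] elts_irrefl[of "num n"] by (metis imageI lessThan_iff)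

lemma num_eq_iff [simp]: "num m = num n \<longleftrightarrow> m = n"
  using num_neq by (metis linorder_neqE_nat)

lemma num_mem_num [simp]: "num m \<in> elts (num n) \<longleftrightarrow> m < n"
  by (auto simp: elts_num)

lemma inj_num: "inj num" by (auto intro: injI)

definition opairs :: "hc set \<Rightarrow> hc set \<Rightarrow> hc set" where
  "opairs A B = {opair x y | x y. x \<in> A \<and> y \<in> B}"

text \<open>
  A transitive set such that it and all its elements are empty or successors is a natural number: by
  \<open>\<in>\<close>-induction, since its predecessor has the same property. Thus the set of natural numbers is
  definable.
\<close>

lemma num_characterization:
  assumes "\<forall>y\<in>elts x. elts y \<subseteq> elts x"
    and "\<forall>y\<in>insert x (elts x). elts y = {} \<or> (\<exists>u. y = succ u)"
  shows "x \<in> range num"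
  using assms
proof (induction x rule: wf_induct_rule[OF wf_mem_rel])
  case (1 x)
  consider "elts x = {}" | u where "x = succ u" using 1(3) by blast
  then show ?case
  proof cases
    case 1
    then have "x = num 0" by (simp add: elts_set_of flip: elts_eq_iff)
    then show ?thesis by blast
  next
    case u: 2
    have "elts v \<subseteq> elts u" if "v \<in> elts u" for v
    proof
      fix w assume "w \<in> elts v"
      then have "w \<in> elts x" using 1(2) that u by (auto simp: elts_succ)
      moreover have "w \<noteq> u" using \<open>w \<in> elts v\<close> that elts_asym by blast
      ultimately show "w \<in> elts u" by (simp add: u elts_succ)
    qed
    then have "u \<in> range num"
      using 1(1)[of u] 1(3) u by (auto simp: elts_succ mem_rel_def)
    then obtain n where "u = num n" by blast
    then have "x = num (Suc n)" using u by simp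
    then show ?thesis by blast
  qed
qed

context zf_model begin

lemma pairing: "x \<in> V \<Longrightarrow> y \<in> V \<Longrightarrow> coded {x, y}"
  using model[unfolded transitive_model_def, THEN conjunct2, THEN conjunct1]
  unfolding coded_def by blast

lemma coded_Union: "coded X \<Longrightarrow> coded (\<Union>y\<in>X. elts y)"
  using model[unfolded transitive_model_def, THEN conjunct2, THEN conjunct2, THEN conjunct1]
  unfolding coded_def by blast

lemma coded_Pow: "coded X \<Longrightarrow> coded {y \<in> V. elts y \<subseteq> X}"
  using model[unfolded transitive_model_def, THEN conjunct2, THEN conjunct2, THEN conjunct2, THEN conjunct1]
  unfolding coded_def by blast

lemma coded_Un: assumes "coded X" "coded Y" shows "coded (X \<union> Y)"
proof -
  obtain x y where "x \<in> V" "elts x = X" "y \<in> V" "elts y = Y" using assms by (auto simp: coded_def)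
  then show ?thesis using coded_Union[OF pairing, of x y] by simp
qed

lemma coded_insert: "x \<in> V \<Longrightarrow> coded X \<Longrightarrow> coded (insert x X)"
  using coded_Un[OF pairing[of x x], of X] by simp

lemma coded_empty: "coded {}"
  using ex_env separation[of "elts (e 0)" "\<lambda>_. False" for e] definable_False env_app coded_elts by fastforce

lemma coded_finite: "finite X \<Longrightarrow> X \<subseteq> V \<Longrightarrow> coded X"
  by (induction X rule: finite_induct) (auto intro: coded_empty coded_insert)

lemma opair_V: "x \<in> V \<Longrightarrow> y \<in> V \<Longrightarrow> opair x y \<in> V"
  unfolding opair_def by (intro coded_set_of coded_finite) (auto intro!: coded_set_of coded_finite)

lemma opair_V_iff [simp]: "opair x y \<in> V \<longleftrightarrow> x \<in> V \<and> y \<in> V"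
proof
  assume "opair x y \<in> V"
  then have "set_of {x, y} \<in> V" by (rule trans_V[rotated]) (simp add: elts_opair)
  then show "x \<in> V \<and> y \<in> V" by (metis trans_V elts_set_of countable_insert countable_empty insertI1 insertI2)
qed (simp add: opair_V)

lemma opair_elts_V: "opair x y \<in> elts f \<Longrightarrow> f \<in> V \<Longrightarrow> x \<in> V \<and> y \<in> V"
  using trans_V opair_V_iff by blast

lemma succ_V: "x \<in> V \<Longrightarrow> succ x \<in> V"
  unfolding succ_def by (intro coded_set_of coded_insert) simp_all

lemma num_V [simp]: "num n \<in> V"
  by (induction n) (auto intro: succ_V coded_set_of coded_empty)

lemma defterm_pair: "defterm t \<Longrightarrow> defterm s \<Longrightarrow> defterm (\<lambda>e. set_of {t e, s e})"
  by (intro defterm_set_of defclass_insert defclass_empty) (auto intro: pairing defterm_V)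

lemma defterm_opair: 
  assumes "defterm t" "defterm s" shows "defterm (\<lambda>e. opair (t e) (s e))"
  using defterm_pair[OF defterm_pair[OF assms(1) assms(1)] defterm_pair[OF assms]] by (simp add: opair_def)

lemma defterm_succ: "defterm t \<Longrightarrow> defterm (\<lambda>e. succ (t e))"
  unfolding succ_def by (intro defterm_set_of defclass_insert defclass_elts; (simp add: coded_insert defterm_V)?)

lemma definable_is_num: assumes "defterm t" shows "definable (\<lambda>e. t e \<in> range num)"
proof (rule definable_cong)
  let ?P = "\<lambda>x. (\<forall>y\<in>elts x. elts y \<subseteq> elts x) \<and> (\<forall>y\<in>insert x (elts x). elts y = {} \<or> (\<exists>u\<in>V. y = succ u))"
  fix e assume e: "env e"
  show "(t e \<in> range num) = ?P (t e)"
  proof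
    assume "t e \<in> range num"
    then obtain n where n: "t e = num n" by blast
    have "elts (num k) = {} \<or> (\<exists>u\<in>V. num k = succ u)" for k
      by (cases k) (auto simp: elts_set_of)
    then show "?P (t e)" unfolding n by (auto simp: elts_num)
  next
    assume "?P (t e)"
    then show "t e \<in> range num" by (intro num_characterization) auto
  qed
next
  show "definable (\<lambda>e. (\<forall>y\<in>elts (t e). elts y \<subseteq> elts (t e)) \<and>
    (\<forall>y\<in>insert (t e) (elts (t e)). elts y = {} \<or> (\<exists>u\<in>V. y = succ u)))"
    by (intro definable_conj definable_ball definable_subset definable_disj definable_exV definable_eq defterm_succ definable_set_eq defclass_insert
       defclass_elts defclass_empty defterm_var defterm_tl_env assms)
qed

lemma coded_omega: "coded (range num)"
proof -
  obtain z where z: "z \<in> V" "set_of {} \<in> elts z" "\<forall>x\<in>elts z. succ x \<in> elts z"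
    using model[unfolded transitive_model_def, THEN conjunct2, THEN conjunct2, THEN conjunct2,
       THEN conjunct2, THEN conjunct1] by blast
  have "num n \<in> elts z" for n by (induction n) (use z in auto)
  then have "{x \<in> elts z. x \<in> range num} = range num" by blast
  then show ?thesis using separation[OF coded_elts[OF z(1)] definable_is_num[OF defterm_var]] by simp
qed

lemma defclass_omega: "defclass (\<lambda>e. range num)"
  unfolding defclass_def using definable_is_num[OF defterm_var, of 0] by auto

lemma defclass_opairs: 
  assumes "defclass X" "defclass Y" shows "defclass (\<lambda>e. opairs (X e) (Y e))"
  unfolding opairs_def
proof (rule defclass_Collect)
  show "definable (\<lambda>e. \<exists>x y. e 0 = opair x y \<and> x \<in> X (tl_env e) \<and> y \<in> Y (tl_env e))"
    by (intro definable_ex definable_conj definable_in definable_eq defterm_opair defterm_var defterm_tl_env defclass_tl_env assms)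
     (blast intro: defclass_subset_V[OF assms(1)] defclass_subset_V[OF assms(2)])+
qed (use defclass_subset_V[OF assms(1)] defclass_subset_V[OF assms(2)] in auto)

text \<open>
  Kuratowski pairs lie two power sets above their components, which bounds the product.
\<close>

lemma coded_opairs:
  assumes "coded A" "coded B" shows "coded (opairs A B)"
proof -
  obtain a b where a: "a \<in> V" "elts a = A" "b \<in> V" "elts b = B" using assms by (auto simp: coded_def)
  obtain e where e: "env e" using ex_env by blast
  have "defclass (\<lambda>e. opairs (elts a) (elts b))"
    by (intro defclass_opairs defclass_elts defterm_const a)
  from separation_defclass[OF this e _ coded_Pow[OF coded_Pow[OF coded_Un[OF assms]]]]
  have "opairs A B \<subseteq> {y \<in> V. elts y \<subseteq> {y \<in> V. elts y \<subseteq> A \<union> B}} \<Longrightarrow> coded (opairs A B)"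
    using a by simp
  moreover have "set_of {x, y} \<in> V" if "x \<in> V" "y \<in> V" for x y
    using pairing[OF that] coded_set_of by blast
  from this this[of x x for x] 
  have "opair x y \<in> V \<and> elts (opair x y) \<subseteq> {y \<in> V. elts y \<subseteq> A \<union> B}" if "x \<in> A" "y \<in> B" for x y
    using coded_V[OF assms(1)] coded_V[OF assms(2)] that
    by (simp add: elts_opair elts_set_of subset_iff)
  then have "opairs A B \<subseteq> {y \<in> V. elts y \<subseteq> {y \<in> V. elts y \<subseteq> A \<union> B}}"
    unfolding opairs_def by blast
  ultimately show ?thesis by blast
qed

section \<open>Finite sets in the model\<close>

lemma finite_if_finite_in: "finite_in A X \<Longrightarrow> finite X"
proof -
  assume "finite_in A X"
  then obtain n f where f: "is_func f" "dom_of f = elts (num n)" "ran_of f = X"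
    unfolding finite_in_def by blast
  have "X \<subseteq> (\<lambda>x. THE y. opair x y \<in> elts f) ` dom_of f"
  proof
    fix y assume "y \<in> X"
    then obtain x where x: "opair x y \<in> elts f" using f(3) by (auto simp: ran_of_def)
    then have "(THE y. opair x y \<in> elts f) = y"
      using f(1) unfolding is_func_def by (intro the_equality) blast+
    then show "y \<in> (\<lambda>x. THE y. opair x y \<in> elts f) ` dom_of f"
      using x by (auto simp: dom_of_def intro!: rev_image_eqI)
  qed
  then show "finite X" using f(2) by (auto simp: elts_num intro: finite_subset)
qed

text \<open>
  Finiteness is absolute: an enumeration of a finite subset of \<open>V\<close> is a finite set of pairs from \<open>V\<close>,
  hence a member of \<open>V\<close>.
\<close>

lemma finite_in_iff: "finite_in V X \<longleftrightarrow> finite X \<and> X \<subseteq> V"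
proof
  assume "finite_in V X"
  then show "finite X \<and> X \<subseteq> V"
    using finite_if_finite_in by (auto simp: finite_in_def ran_of_def dest: opair_elts_V)
next
  assume "finite X \<and> X \<subseteq> V"
  then have fX: "finite X" "X \<subseteq> V" by auto
  from ex_bij_betw_nat_finite[OF fX(1)] obtain h where h: "bij_betw h {0..<card X} X" by blast
  define f where "f = set_of {opair (num i) (h i) | i. i < card X}"
  have hV: "h i \<in> V" if "i < card X" for i using that h fX by (auto simp: bij_betw_def)
  have "coded {opair (num i) (h i) | i. i < card X}"
    by (rule coded_finite) (use hV in auto)
  then have f: "f \<in> V" "elts f = {opair (num i) (h i) | i. i < card X}"
    unfolding f_def by (simp_all add: coded_set_of coded_elts_set_of)
  have inj: "h i = h j \<Longrightarrow> i < card X \<Longrightarrow> j < card X \<Longrightarrow> i = j" for i j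
    using h by (auto simp: bij_betw_def inj_on_def)
  have "is_func f" unfolding is_func_def f by auto
  moreover have "dom_of f = elts (num (card X))" by (auto simp: dom_of_def f elts_num)
  moreover have "ran_of f = X"
    using h by (force simp: ran_of_def f bij_betw_def image_def)
  moreover have "\<forall>x x' y. opair x y \<in> elts f \<and> opair x' y \<in> elts f \<longrightarrow> x = x'"
    using inj by (auto simp: f)
  ultimately show "finite_in V X" unfolding finite_in_def using f(1) by blast
qed

end

section \<open>Finite sequences and trees as lists\<close>

definition enc :: "nat list \<Rightarrow> hc" where
  "enc l = set_of {opair (num i) (num (l ! i)) | i. i < length l}"

lemma elts_enc: "elts (enc l) = {opair (num i) (num (l ! i)) | i. i < length l}"
  unfolding enc_def by (rule elts_set_of) (auto intro: countable_finite)

text \<open>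
  Turns the extension of finite sequences, which is inclusion of their graphs, into the prefix order of
  lists.
\<close>

lemma enc_subset_iff: "elts (enc l) \<subseteq> elts (enc l') \<longleftrightarrow> (\<exists>r. l' = l @ r)"
proof
  assume *: "elts (enc l) \<subseteq> elts (enc l')"
  have "i < length l' \<and> l' ! i = l ! i" if "i < length l" for i
    using * that by (force simp: elts_enc)
  moreover from this have "length l \<le> length l'" by (metis leI less_irrefl)
  ultimately have "l = take (length l) l'"
    by (intro nth_equalityI) auto
  then show "\<exists>r. l' = l @ r" by (metis append_take_drop_id)
qed (auto simp: elts_enc nth_append)

lemma enc_eq_iff [simp]: "enc l = enc l' \<longleftrightarrow> l = l'"
  using enc_subset_iff[of l l'] enc_subset_iff[of l' l] by auto

lemma is_func_unique: "is_func f \<Longrightarrow> opair x y \<in> elts f \<Longrightarrow> opair x y' \<in> elts f \<Longrightarrow> y = y'"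
  unfolding is_func_def by blast

lemma is_func_pair: "is_func f \<Longrightarrow> z \<in> elts f \<Longrightarrow> \<exists>x y. z = opair x y"
  unfolding is_func_def by blast

definition rfun :: "hc \<Rightarrow> nat \<Rightarrow> nat" where
  "rfun f i = (THE k. opair (num i) (num k) \<in> elts f)"

lemma rfun_eq: "is_func f \<Longrightarrow> opair (num i) (num k) \<in> elts f \<Longrightarrow> rfun f i = k"
  unfolding rfun_def by (rule the_equality) (auto dest: is_func_unique)

lemma rfun_mem:
  assumes "is_func f" "num i \<in> dom_of f" "ran_of f \<subseteq> range num"
  shows "opair (num i) (num (rfun f i)) \<in> elts f"
proof -
  obtain y where y: "opair (num i) y \<in> elts f" using assms by (auto simp: dom_of_def)
  then have "y \<in> ran_of f" by (auto simp: ran_of_def)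
  then obtain k where "y = num k" using assms(3) by blast
  then show ?thesis using rfun_eq[OF assms(1)] y by metis
qed

lemma enc_seqs: "enc l \<in> seqs n \<longleftrightarrow> length l = n"
proof -
  have "is_func (enc l)" by (auto simp: is_func_def elts_enc)
  moreover have "dom_of (enc l) = elts (num (length l))" by (auto simp: dom_of_def elts_enc elts_num)
  moreover have "ran_of (enc l) \<subseteq> range num" by (auto simp: ran_of_def elts_enc)
  moreover have "elts (num (length l)) = elts (num n) \<longleftrightarrow> length l = n" by (simp add: elts_eq_iff)
  ultimately show ?thesis by (simp add: seqs_def)
qed

lemma seqs_eq: "seqs n = enc ` {l. length l = n}"
proof (intro set_eqI iffI)
  fix s assume s: "s \<in> seqs n"
  define l where "l = map (rfun s) [0..<n]"
  have f: "is_func s" "dom_of s = elts (num n)" "ran_of s \<subseteq> range num" using s by (auto simp: seqs_def)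
  have "elts s = elts (enc l)"
  proof (intro set_eqI iffI)
    fix z assume z: "z \<in> elts s"
    then obtain x y where xy: "z = opair x y" using f(1) is_func_pair by blast
    then have "x \<in> dom_of s" "y \<in> ran_of s" using z by (auto simp: dom_of_def ran_of_def)
    then obtain i k where "x = num i" "i < n" "y = num k" using f by (auto simp: elts_num)
    then show "z \<in> elts (enc l)" using rfun_eq[OF f(1), of i k] z xy by (auto simp: elts_enc l_def)
  next
    fix z assume "z \<in> elts (enc l)"
    then obtain i where "i < n" "z = opair (num i) (num (rfun s i))" by (auto simp: elts_enc l_def)
    then show "z \<in> elts s" using rfun_mem[OF f(1) _ f(3), of i] f(2) by (simp add: elts_num)
  qed
  then have "s = enc l" by (simp add: elts_eq_iff)
  then show "s \<in> enc ` {l. length l = n}" by (simp add: l_def)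
qed (auto simp: enc_seqs)

lemma UN_seqs: "(\<Union>n. seqs n) = range enc" "(\<Union>m\<le>n. seqs m) = enc ` {l. length l \<le> n}"
  by (auto simp: seqs_eq)

definition ltree :: "nat list set \<Rightarrow> bool" where
  "ltree A \<longleftrightarrow> A \<noteq> {} \<and> (\<forall>l r. l @ r \<in> A \<longrightarrow> l \<in> A)"

lemma ltree_Nil: "ltree A \<Longrightarrow> [] \<in> A"
  unfolding ltree_def by (metis append_Nil ex_in_conv)

lemma tree_enc: "tree (enc ` A) \<longleftrightarrow> ltree A"
proof -
  have "(\<forall>s\<in>enc ` A. \<forall>t\<in>range enc. elts t \<subseteq> elts s \<longrightarrow> t \<in> enc ` A) \<longleftrightarrow> (\<forall>l r. l @ r \<in> A \<longrightarrow> l \<in> A)"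
    by (auto simp: enc_subset_iff image_iff)
  then show ?thesis unfolding tree_def ltree_def UN_seqs by auto
qed

lemma tree_obtain:
  assumes "tree T" obtains A where "T = enc ` A" "ltree A"
proof -
  have "T \<subseteq> range enc" using assms by (simp add: tree_def UN_seqs)
  then obtain A where "T = enc ` A" by (metis subset_imageE)
  then show ?thesis using that assms tree_enc by blast
qed

lemma succs_enc: "succs (enc ` A) (enc l) = (\<lambda>k. enc (l @ [k])) ` {k. l @ [k] \<in> A}"
proof (intro set_eqI iffI)
  fix t assume "t \<in> succs (enc ` A) (enc l)"
  then obtain n r where *: "t = enc (l @ r)" "l @ r \<in> A" "length l = n" "length (l @ r) = Suc n"
    by (auto simp: succs_def enc_subset_iff enc_seqs)
  then obtain k where "r = [k]" by (auto simp: length_Suc_conv)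
  then show "t \<in> (\<lambda>k. enc (l @ [k])) ` {k. l @ [k] \<in> A}" using * by auto
next
  fix t assume "t \<in> (\<lambda>k. enc (l @ [k])) ` {k. l @ [k] \<in> A}"
  then obtain k where k: "t = enc (l @ [k])" "l @ [k] \<in> A" by blast
  moreover have "elts (enc l) \<subseteq> elts t" unfolding k enc_subset_iff by blast
  ultimately show "t \<in> succs (enc ` A) (enc l)" by (simp add: succs_def enc_seqs)
qed

lemma finite_enc_succs: "finite ((\<lambda>k. enc (l @ [k])) ` B) \<longleftrightarrow> finite B"
  by (rule finite_image_iff) (auto intro: inj_onI)

definition splits :: "nat list set \<Rightarrow> nat list \<Rightarrow> bool" where
  "splits A l \<longleftrightarrow> {k. l @ [k] \<in> A} \<noteq> {} \<and> finite {k. l @ [k] \<in> A}"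

text \<open>
  The counterpart for lists of the finitely splitting trees of height \<open>n\<close>.
\<close>

definition ntree :: "nat \<Rightarrow> nat list set \<Rightarrow> bool" where
  "ntree n A \<longleftrightarrow> ltree A \<and> (\<forall>l\<in>A. length l \<le> n) \<and> (\<forall>l\<in>A. length l < n \<longrightarrow> splits A l)"

lemma ltree_level_finite:
  assumes "ltree A" "\<forall>l\<in>A. length l < n \<longrightarrow> splits A l"
  shows "finite {l \<in> A. length l = n}"
  using assms(2)
proof (induction n)
  case 0
  have "{l \<in> A. length l = 0} \<subseteq> {[]}" by auto
  then show ?case using finite_subset by blast
next
  case (Suc n)
  have "{l \<in> A. length l = Suc n} \<subseteq> (\<Union>l\<in>{l \<in> A. length l = n}. (\<lambda>k. l @ [k]) ` {k. l @ [k] \<in> A})"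
  proof
    fix l assume l: "l \<in> {l \<in> A. length l = Suc n}"
    then obtain l' k where "l = l' @ [k]" "length l' = n" 
      by (cases l rule: rev_cases) auto
    then show "l \<in> (\<Union>l\<in>{l \<in> A. length l = n}. (\<lambda>k. l @ [k]) ` {k. l @ [k] \<in> A})"
      using l assms(1) by (auto simp: ltree_def)
  qed
  moreover have "finite \<dots>" using Suc by (auto simp: splits_def)
  ultimately show ?case by (rule finite_subset)
qed

lemma ltree_levels_finite:
  assumes "ltree A" "\<forall>l\<in>A. length l < n \<longrightarrow> splits A l"
  shows "finite {l \<in> A. length l \<le> n}"
proof -
  have "{l \<in> A. length l \<le> n} = (\<Union>m\<le>n. {l \<in> A. length l = m})" by auto
  also have "finite \<dots>" using ltree_level_finite[OF assms(1)] assms(2) by fastforce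
  finally show ?thesis .
qed

lemma ntree_finite: "ntree n A \<Longrightarrow> finite A"
  using ltree_levels_finite[of A n] by (auto simp: ntree_def elim: rev_finite_subset)

lemma ntree_level_nonempty:
  assumes "ntree n A" "m \<le> n" shows "\<exists>l\<in>A. length l = m"
  using assms(2)
proof (induction m)
  case 0 then show ?case using assms ltree_Nil by (auto simp: ntree_def)
next
  case (Suc m)
  then obtain l where l: "l \<in> A" "length l = m" by auto
  then have "splits A l" using assms Suc by (auto simp: ntree_def)
  then obtain k where "l @ [k] \<in> A" by (auto simp: splits_def)
  then show ?case using l by force
qed

context zf_model begin

lemma enc_V [simp]: "enc l \<in> V"
  unfolding enc_def by (intro coded_set_of coded_finite) auto

lemma seqs_V: "seqs n \<subseteq> V"
  by (auto simp: seqs_eq)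

lemma succs_splits: "(succs (enc ` A) (enc l) \<noteq> {} \<and> finite_in V (succs (enc ` A) (enc l))) \<longleftrightarrow> splits A l"
  by (auto simp: finite_in_iff succs_enc finite_enc_succs splits_def)

lemma fs_tree_enc: "fs_tree V (enc ` A) \<longleftrightarrow> ltree A \<and> (\<forall>l\<in>A. splits A l)"
  by (simp add: fs_tree_def tree_enc succs_splits)

lemma fs_ntree_enc: "fs_ntree V n (enc ` A) \<longleftrightarrow> ntree n A"
proof -
  have "(\<forall>m<n. \<forall>s \<in> enc ` A \<inter> seqs m. succs (enc ` A) s \<noteq> {} \<and> finite_in V (succs (enc ` A) s))
     \<longleftrightarrow> (\<forall>l\<in>A. length l < n \<longrightarrow> splits A l)"
    by (auto simp: enc_seqs succs_splits[symmetric])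
  moreover have "enc ` A \<subseteq> enc ` {l. length l \<le> n} \<longleftrightarrow> (\<forall>l\<in>A. length l \<le> n)" by auto
  ultimately show ?thesis unfolding fs_ntree_def ntree_def tree_enc UN_seqs by auto
qed

lemma fs_ntree_obtain:
  assumes "fs_ntree V n T" obtains A where "T = enc ` A" "ntree n A"
proof -
  have "tree T" using assms by (simp add: fs_ntree_def)
  then obtain A where "T = enc ` A" by (rule tree_obtain)
  then show ?thesis using that assms fs_ntree_enc by blast
qed

lemma fs_tree_obtain:
  assumes "fs_tree V T" obtains A where "T = enc ` A" "ltree A" "\<forall>l\<in>A. splits A l"
proof -
  have "tree T" using assms by (simp add: fs_tree_def)
  then obtain A where "T = enc ` A" by (rule tree_obtain)
  then show ?thesis using that assms fs_tree_enc by blast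
qed

end

section \<open>Definability of the forcing\<close>

declare num.simps [simp del]

text \<open>
  Quantifiers over type \<open>nat\<close> become quantifiers over \<open>\<omega>\<close> by means of this inverse of \<open>num\<close>.
  The value 0 off \<open>\<omega>\<close> makes it a total operation on \<open>V\<close>.
\<close>

definition unnum :: "hc \<Rightarrow> nat" where
  "unnum x = (if x \<in> range num then inv num x else 0)"

lemma unnum_num [simp]: "unnum (num n) = n"
  by (simp add: unnum_def inj_num)

lemma num_unnum: "num (unnum x) = (if x \<in> range num then x else num 0)"
  by (auto simp: unnum_def inj_num)

context zf_model begin

lemma defterm_if:
  assumes "definable P" "defterm t" "defterm s" shows "defterm (\<lambda>e. if P e then t e else s e)"
proof -
  have "definable (\<lambda>e. (P (tl_env e) \<and> e 0 = t (tl_env e)) \<or> (\<not> P (tl_env e) \<and> e 0 = s (tl_env e)))"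
    by (intro definable_conj definable_disj definable_not definable_tl_env[OF assms(1)] definable_eq defterm_var defterm_tl_env[OF assms(2)] defterm_tl_env[OF assms(3)])
  then have "definable (\<lambda>e. e 0 = (if P (tl_env e) then t (tl_env e) else s (tl_env e)))"
    by (rule definable_cong[rotated]) auto
  then show ?thesis using assms defterm_V unfolding defterm_def[of "\<lambda>e. if P e then t e else s e"] by auto
qed

abbreviation natterm :: "((nat \<Rightarrow> hc) \<Rightarrow> nat) \<Rightarrow> bool" where
  "natterm \<nu> \<equiv> defterm (\<lambda>e. num (\<nu> e))"

lemma natterm_unnum: "defterm t \<Longrightarrow> natterm (\<lambda>e. unnum (t e))"
  unfolding num_unnum by (intro defterm_if definable_is_num defterm_const) simp_all

lemma natterm_const: "natterm (\<lambda>e. n)"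
  by (rule defterm_const) simp

lemma natterm_Suc: "natterm \<nu> \<Longrightarrow> natterm (\<lambda>e. Suc (\<nu> e))"
  unfolding num.simps by (rule defterm_succ)

lemma definable_exN: 
  assumes "definable (\<lambda>e. Q (unnum (e 0)) (tl_env e))" shows "definable (\<lambda>e. \<exists>n. Q n e)"
proof -
  have "definable (\<lambda>e. \<exists>x\<in>range num. Q (unnum x) e)" by (intro definable_bex defclass_omega assms)
  then show ?thesis by simp
qed

lemma definable_allN: 
  assumes "definable (\<lambda>e. Q (unnum (e 0)) (tl_env e))" shows "definable (\<lambda>e. \<forall>n. Q n e)"
proof -
  have "definable (\<lambda>e. \<forall>x\<in>range num. Q (unnum x) e)" by (intro definable_ball defclass_omega assms)
  then show ?thesis by simp
qed

lemma definable_less: "natterm m \<Longrightarrow> natterm n \<Longrightarrow> definable (\<lambda>e. m e < n e)"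
  using definable_mem[of "\<lambda>e. num (m e)" "\<lambda>e. num (n e)"] by simp

lemma definable_le: "natterm m \<Longrightarrow> natterm n \<Longrightarrow> definable (\<lambda>e. m e \<le> n e)"
  using definable_not[OF definable_less[of n m]] by (simp add: not_less)

lemma defclass_V: "defclass (\<lambda>e. V)"
  unfolding defclass_def by (auto intro: definable_cong[OF _ definable_True])

text \<open>
  Rules for \<open>intro\<close>. The rules that drop \<open>tl_env\<close> are kept apart, because they apply to constant
  terms without making progress; they must come last.
\<close>

lemmas definable_intros =
  definable_conj definable_disj definable_imp definable_iff definable_not definable_eq definable_set_eq definable_subset
  definable_allV definable_exV definable_ball definable_bex definable_all definable_ex definable_exN definable_allN definable_less definable_le definable_in
  defclass_omega defclass_empty defclass_insert defclass_Un defclass_Int defclass_Diff defclass_elts defclass_opairs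
  defterm_var natterm_const natterm_unnum natterm_Suc defterm_opair defterm_pair defterm_succ

lemmas definable_shift_intros = defterm_tl_env defclass_tl_env

lemma defclassI:
  assumes "\<And>e x. env e \<Longrightarrow> x \<in> X e \<Longrightarrow> x \<in> V" "definable (\<lambda>e. e 0 \<in> X (tl_env e))" shows "defclass X"
  using assms by (auto simp: defclass_def)

lemma defclass_dom_of: assumes "defterm t" shows "defclass (\<lambda>e. dom_of (t e))"
  unfolding dom_of_def
  by (rule defclass_Collect) (intro definable_intros assms definable_shift_intros | use opair_elts_V defterm_V[OF assms] in blast)+

lemma defclass_ran_of: assumes "defterm t" shows "defclass (\<lambda>e. ran_of (t e))"
  unfolding ran_of_def
  by (rule defclass_Collect) (intro definable_intros assms definable_shift_intros | use opair_elts_V defterm_V[OF assms] in blast)+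

lemma definable_is_func: assumes "defterm t" shows "definable (\<lambda>e. is_func (t e))"
proof (rule definable_cong)
  show "definable (\<lambda>e. (\<forall>z\<in>elts (t e). \<exists>x\<in>V. \<exists>y\<in>V. z = opair x y) \<and>
     (\<forall>x\<in>V. \<forall>y\<in>V. \<forall>y'\<in>V. opair x y \<in> elts (t e) \<and> opair x y' \<in> elts (t e) \<longrightarrow> y = y'))"
    by (intro definable_intros defclass_V assms definable_shift_intros)
  fix e assume e: "env e"
  have *: "x \<in> V \<and> y \<in> V" if "opair x y \<in> elts (t e)" for x y
    using opair_elts_V[OF that defterm_V[OF assms e]] .
  have "(\<forall>z\<in>elts (t e). \<exists>x y. z = opair x y) \<longleftrightarrow> (\<forall>z\<in>elts (t e). \<exists>x\<in>V. \<exists>y\<in>V. z = opair x y)"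
    by (rule ball_cong) (use * in auto)
  moreover have "(\<forall>x y y'. opair x y \<in> elts (t e) \<and> opair x y' \<in> elts (t e) \<longrightarrow> y = y') \<longleftrightarrow>
    (\<forall>x\<in>V. \<forall>y\<in>V. \<forall>y'\<in>V. opair x y \<in> elts (t e) \<and> opair x y' \<in> elts (t e) \<longrightarrow> y = y')"
    using * by meson
  ultimately show "is_func (t e) \<longleftrightarrow> ((\<forall>z\<in>elts (t e). \<exists>x\<in>V. \<exists>y\<in>V. z = opair x y) \<and>
     (\<forall>x\<in>V. \<forall>y\<in>V. \<forall>y'\<in>V. opair x y \<in> elts (t e) \<and> opair x y' \<in> elts (t e) \<longrightarrow> y = y'))"
    unfolding is_func_def by (rule arg_cong2)
qed

lemma defclass_seqs: assumes "natterm \<nu>" shows "defclass (\<lambda>e. seqs (\<nu> e))"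
proof (rule defclassI)
  show "definable (\<lambda>e. e 0 \<in> seqs (\<nu> (tl_env e)))" unfolding seqs_def mem_Collect_eq
    by (intro definable_intros definable_is_func defclass_dom_of defclass_ran_of assms definable_shift_intros)
qed (use seqs_V in auto)

lemma defclass_UN_nat:
  assumes "defclass (\<lambda>e. X (unnum (e 0)) (tl_env e))" shows "defclass (\<lambda>e. \<Union>n. X n e)"
proof -
  have *: "x \<in> V" if "env e" "x \<in> X n e" for e x n
    using defclass_subset_V[OF assms, of "case_nat (num n) e" x] that by simp
  have "definable (\<lambda>e. e 0 \<in> X (unnum (e 1)) (tl_env (tl_env e)))"
    using assms unfolding defclass_def tl_env_def by simp
  from definable_reindex[OF this, of "case_nat 1 (case_nat 0 (\<lambda>i. Suc (Suc i)))"]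
  have "definable (\<lambda>e. \<exists>n. e 0 \<in> X n (tl_env e))"
    by (intro definable_exN) (simp add: tl_env_def)
  then show ?thesis unfolding defclass_def using * by auto
qed

lemma defclass_Seq: "defclass (\<lambda>e. \<Union>n. seqs n)"
  by (intro defclass_UN_nat defclass_seqs natterm_unnum defterm_var)

lemma defclass_Seq_le: assumes "natterm \<nu>" shows "defclass (\<lambda>e. \<Union>m\<le>\<nu> e. seqs m)"
proof (rule defclassI)
  show "definable (\<lambda>e. e 0 \<in> (\<Union>m\<le>\<nu> (tl_env e). seqs m))"
    unfolding UN_iff Bex_def atMost_iff by (intro definable_intros defclass_seqs assms definable_shift_intros)
qed (use seqs_V in auto)

lemma definable_tree: "defclass X \<Longrightarrow> definable (\<lambda>e. tree (X e))"
  unfolding tree_def by (intro definable_intros defclass_Seq definable_shift_intros)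

lemma defclass_succs:
  assumes "defclass X" "defterm t" shows "defclass (\<lambda>e. succs (X e) (t e))"
  unfolding succs_def
proof (rule defclass_Collect)
  show "definable (\<lambda>e. e 0 \<in> X (tl_env e) \<and> elts (t (tl_env e)) \<subseteq> elts (e 0) \<and>
    (\<exists>n. t (tl_env e) \<in> seqs n \<and> e 0 \<in> seqs (Suc n)))"
    by (intro definable_intros defclass_seqs assms definable_shift_intros)
qed (use defclass_subset_V[OF assms(1)] in blast)

lemma definable_finite_in:
  assumes "defclass X" shows "definable (\<lambda>e. finite_in V (X e))"
proof -
  have "definable (\<lambda>e. \<exists>n. \<exists>f\<in>V. is_func f \<and> dom_of f = elts (num n) \<and> ran_of f = X e \<and>
     (\<forall>x\<in>V. \<forall>x'\<in>V. \<forall>y\<in>V. opair x y \<in> elts f \<and> opair x' y \<in> elts f \<longrightarrow> x = x'))"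
    by (intro definable_intros defclass_V definable_is_func defclass_dom_of defclass_ran_of assms definable_shift_intros)
  moreover have "(\<forall>x x' y. opair x y \<in> elts f \<and> opair x' y \<in> elts f \<longrightarrow> x = x') \<longleftrightarrow>
     (\<forall>x\<in>V. \<forall>x'\<in>V. \<forall>y\<in>V. opair x y \<in> elts f \<and> opair x' y \<in> elts f \<longrightarrow> x = x')" if "f \<in> V" for f
    using opair_elts_V that by meson
  ultimately show ?thesis unfolding finite_in_def by (simp cong: bex_cong)
qed

lemma definable_fs_ntree:
  assumes "defclass X" "natterm \<nu>" shows "definable (\<lambda>e. fs_ntree V (\<nu> e) (X e))"
proof -
  have "definable (\<lambda>e. tree (X e) \<and> X e \<subseteq> (\<Union>m\<le>\<nu> e. seqs m) \<and>
     (\<forall>m. m<\<nu> e \<longrightarrow> (\<forall>s \<in> X e \<inter> seqs m. succs (X e) s \<noteq> {} \<and> finite_in V (succs (X e) s))))"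
    by (intro definable_intros definable_tree defclass_Seq_le definable_finite_in defclass_succs defclass_seqs assms definable_shift_intros)
  then show ?thesis unfolding fs_ntree_def by simp
qed

lemma defclass_cond_tree:
  assumes "defterm p" "defterm i" shows "defclass (\<lambda>e. cond_tree (p e) (i e))"
  unfolding cond_tree_def
proof (rule defclass_Collect)
  show "definable (\<lambda>e. opair (opair (i (tl_env e)) (e 0)) (num 1) \<in> elts (p (tl_env e)))"
    by (intro definable_intros assms definable_shift_intros)
qed (use opair_elts_V defterm_V[OF assms(1)] opair_V_iff in blast)

lemma definable_in_baire: assumes "defterm t" shows "definable (\<lambda>e. t e \<in> baire)"
  unfolding baire_def mem_Collect_eq
  by (intro definable_intros definable_is_func defclass_dom_of defclass_ran_of assms definable_shift_intros)

lemma defterm_restr: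
  assumes "defterm t" "natterm \<nu>" shows "defterm (\<lambda>e. restr (t e) (\<nu> e))"
  unfolding restr_def
proof (rule defterm_set_of)
  show *: "defclass (\<lambda>e. {z \<in> elts (t e). \<exists>x\<in>elts (num (\<nu> e)). \<exists>y. z = opair x y})"
  proof (rule defclass_Collect)
    show "definable (\<lambda>e. e 0 \<in> elts (t (tl_env e)) \<and> (\<exists>x\<in>elts (num (\<nu> (tl_env e))). \<exists>y. e 0 = opair x y))"
      by (intro definable_intros assms definable_shift_intros) (metis env_app env_tl_env opair_V_iff)
  qed (use trans_V defterm_V[OF assms(1)] in blast)
  fix e assume "env e"
  then show "coded {z \<in> elts (t e). \<exists>x\<in>elts (num (\<nu> e)). \<exists>y. z = opair x y}"
    by (intro separation_defclass[OF *, of e "elts (t e)"]) (auto intro!: coded_elts defterm_V[OF assms(1)])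
qed

lemma defclass_W_reals: assumes "\<T> \<in> V" shows "defclass (\<lambda>e. W_reals V \<T>)"
  unfolding W_reals_def branches_def
proof (rule defclass_Collect)
  show "definable (\<lambda>e. e 0 \<in> V \<inter> baire \<and> (\<forall>T\<in>elts \<T>. e 0 \<notin> {f \<in> baire. \<forall>n. restr f n \<in> elts T}))"
    unfolding mem_Collect_eq Int_iff
    by (intro definable_in_baire definable_intros defclass_V defterm_restr defterm_const assms definable_shift_intros)
qed auto

lemma definable_tree_cond: 
  assumes "defterm p" "defterm F" "natterm \<nu>" shows "definable (\<lambda>e. tree_cond V (elts (F e)) (\<nu> e) (p e))"
proof -
  have "defclass (\<lambda>e. {opair i s | i s. i \<in> elts (F e) \<and> s \<in> (\<Union>m\<le>\<nu> e. seqs m)})"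
    using defclass_opairs[OF defclass_elts[OF assms(2)] defclass_Seq_le[OF assms(3)]] by (simp only: opairs_def)
  then show ?thesis unfolding tree_cond_def
    by (intro definable_intros defclass_V definable_is_func defclass_dom_of defclass_ran_of definable_finite_in defclass_cond_tree definable_fs_ntree assms definable_shift_intros)
qed

lemma definable_side_cond: 
  assumes "defterm w" "\<T> \<in> V" shows "definable (\<lambda>e. side_cond V \<T> (w e))"
  unfolding side_cond_def
  by (intro definable_intros defclass_V definable_is_func defclass_dom_of defclass_ran_of definable_finite_in defclass_W_reals assms definable_shift_intros)

text \<open>
  The definition of the forcing quantifies over a set \<open>F\<close> in the sense of the logic; being finite, it is
  the set of elements of some member of \<open>V\<close>.
\<close>

lemma defclass_tree_forcing: assumes "\<T> \<in> V" shows "defclass (\<lambda>e. tree_forcing V \<T>)"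
proof -
  let ?Q = "\<lambda>c. \<exists>p\<in>V. \<exists>w\<in>V. c = opair p w \<and> (\<exists>F\<in>V. \<exists>n. tree_cond V (elts F) n p \<and> side_cond V \<T> w \<and>
     (\<forall>f\<in>V. \<forall>i\<in>V. opair f i \<in> elts w \<longrightarrow> \<not> i \<in> elts F \<or> restr f n \<in> cond_tree p i))"
  have "defclass (\<lambda>e. {c. ?Q c})"
  proof (rule defclass_Collect)
    show "definable (\<lambda>e. ?Q (e 0))"
      by (intro definable_intros defclass_V definable_tree_cond definable_side_cond defterm_restr defclass_cond_tree assms definable_shift_intros)
  qed (auto simp: opair_V)
  moreover have "{c. ?Q c} = tree_forcing V \<T>"
  proof (intro set_eqI iffI)
    fix c assume "c \<in> {c. ?Q c}"
    then show "c \<in> tree_forcing V \<T>"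
      unfolding tree_forcing_def mem_Collect_eq by (metis opair_elts_V)
  next
    fix c assume "c \<in> tree_forcing V \<T>"
    then obtain p w F n where c: "c = opair p w" "tree_cond V F n p" "side_cond V \<T> w"
      "\<forall>f i. opair f i \<in> elts w \<longrightarrow> i \<notin> F \<or> restr f n \<in> cond_tree p i"
      unfolding tree_forcing_def by blast
    then have "coded F" by (auto simp: tree_cond_def finite_in_iff coded_finite)
    then obtain F' where "F' \<in> V" "elts F' = F" by (auto simp: coded_def)
    moreover have "p \<in> V" "w \<in> V" using c by (auto simp: tree_cond_def side_cond_def)
    ultimately show "c \<in> {c. ?Q c}" using c by blast
  qed
  ultimately show ?thesis by simp
qed

lemma coded_Seq: "coded (\<Union>n. seqs n)"
proof -
  obtain e where e: "env e" using ex_env by blast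
  have "(\<Union>n. seqs n) \<subseteq> {y \<in> V. elts y \<subseteq> opairs (range num) (range num)}"
    by (auto simp: UN_seqs elts_enc opairs_def)
  from separation_defclass[OF defclass_Seq e this coded_Pow[OF coded_opairs[OF coded_omega coded_omega]]] show ?thesis .
qed

lemma is_func_subset: 
  assumes "is_func f" "dom_of f \<subseteq> A" "ran_of f \<subseteq> B" shows "elts f \<subseteq> opairs A B"
proof
  fix z assume z: "z \<in> elts f"
  then obtain x y where xy: "z = opair x y" using is_func_pair[OF assms(1)] by blast
  then have "x \<in> dom_of f" "y \<in> ran_of f" using z by (auto simp: dom_of_def ran_of_def)
  then show "z \<in> opairs A B" using assms xy by (auto simp: opairs_def)
qed

text \<open>
  The two parts of a condition are subsets of products of \<open>\<omega>\<close>, the set of finite sequences, 2 and a set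
  of reals. So power sets taken in \<open>V\<close> bound the forcing, and separation applies.
\<close>

lemma coded_tree_forcing: assumes "\<T> \<in> V" shows "coded (tree_forcing V \<T>)"
proof -
  obtain e where e: "env e" using ex_env by blast
  let ?B = "{y \<in> V. elts y \<subseteq> opairs (range num) (range num)}"
  have B: "coded ?B" by (intro coded_Pow coded_opairs coded_omega)
  have W: "coded (W_reals V \<T>)"
  proof (rule separation_defclass[OF defclass_W_reals[OF assms] e _ B])
    show "W_reals V \<T> \<subseteq> ?B"
      by (auto simp: W_reals_def baire_def dest!: is_func_subset[of _ "range num" "range num"])
  qed
  let ?P = "{y \<in> V. elts y \<subseteq> opairs (opairs (range num) (\<Union>n. seqs n)) {num 0, num 1}}"
  let ?W = "{y \<in> V. elts y \<subseteq> opairs (W_reals V \<T>) (range num)}"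
  have "tree_forcing V \<T> \<subseteq> opairs ?P ?W"
  proof
    fix c assume "c \<in> tree_forcing V \<T>"
    then obtain p w F n where c: "c = opair p w" "tree_cond V F n p" "side_cond V \<T> w"
      unfolding tree_forcing_def by blast
    have "p \<in> ?P"
      using c(2) unfolding tree_cond_def mem_Collect_eq
      by (intro conjI is_func_subset) (auto simp: opairs_def)
    moreover have "w \<in> ?W"
      using c(3) unfolding side_cond_def mem_Collect_eq
      by (intro conjI is_func_subset) auto
    ultimately show "c \<in> opairs ?P ?W" using c(1) by (auto simp: opairs_def)
  qed
  moreover have "coded (opairs ?P ?W)"
    by (intro coded_opairs coded_Pow coded_omega coded_Seq W coded_finite) auto
  ultimately show ?thesis using separation_defclass[OF defclass_tree_forcing[OF assms] e] by blast
qed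

end

section \<open>Check names\<close>

text \<open>
  The usual check names, with a condition \<open>c\<close> in place of the weakest one.
\<close>

function check_name :: "hc \<Rightarrow> hc \<Rightarrow> hc" where
  "check_name c x = set_of ((\<lambda>y. opair (check_name c y) c) ` elts x)"
  by pat_completeness auto
termination
  by (relation "inv_image mem_rel snd") (simp add: wf_mem_rel, simp add: mem_rel_def)

declare check_name.simps [simp del]

lemma elts_check_name: "elts (check_name c x) = (\<lambda>y. opair (check_name c y) c) ` elts x"
  by (subst check_name.simps) (simp add: elts_set_of countable_elts)

text \<open>
  The attempts at the recursion for \<open>check_name c\<close>: relations that are closed downwards along \<open>\<in>\<close>
  and obey the recursion equation. The formula does not mention \<open>check_name\<close>, so it is definable
  over \<open>V\<close>; \<open>check_map_iff\<close> shows that such a relation is a part of the graph of \<open>check_name c\<close>.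
\<close>

definition check_map :: "hc \<Rightarrow> hc \<Rightarrow> bool" where
  "check_map c h \<longleftrightarrow> (\<forall>u v. opair u v \<in> elts h \<longrightarrow>
     (\<forall>a\<in>elts v. \<exists>b\<in>elts u. \<exists>d. a = opair d c \<and> opair b d \<in> elts h) \<and>
     (\<forall>b\<in>elts u. \<exists>d. opair b d \<in> elts h \<and> opair d c \<in> elts v))"

lemma check_map_eq: "check_map c h \<Longrightarrow> opair u v \<in> elts h \<Longrightarrow> v = check_name c u"
proof (induction u arbitrary: v rule: wf_induct_rule[OF wf_mem_rel])
  case (1 u)
  have IH: "d = check_name c b" if "b \<in> elts u" "opair b d \<in> elts h" for b d
    using 1 that by (auto simp: mem_rel_def)
  have *: "\<forall>a\<in>elts v. \<exists>b\<in>elts u. \<exists>d. a = opair d c \<and> opair b d \<in> elts h"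
    "\<forall>b\<in>elts u. \<exists>d. opair b d \<in> elts h \<and> opair d c \<in> elts v"
    using 1(2,3) unfolding check_map_def by blast+
  have "elts v = elts (check_name c u)"
    unfolding elts_check_name using * IH by blast
  then show ?case by (simp add: elts_eq_iff)
qed

lemma check_map_iff:
  "check_map c h \<longleftrightarrow> (\<forall>u v. opair u v \<in> elts h \<longrightarrow>
     v = check_name c u \<and> (\<forall>b\<in>elts u. opair b (check_name c b) \<in> elts h))"
proof
  assume h: "check_map c h"
  show "\<forall>u v. opair u v \<in> elts h \<longrightarrow> v = check_name c u \<and> (\<forall>b\<in>elts u. opair b (check_name c b) \<in> elts h)"
  proof (intro allI impI conjI ballI)
    fix u v assume uv: "opair u v \<in> elts h"
    then show "v = check_name c u" by (rule check_map_eq[OF h])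
    fix b assume "b \<in> elts u"
    then obtain d where "opair b d \<in> elts h" using h uv unfolding check_map_def by meson
    then show "opair b (check_name c b) \<in> elts h" using check_map_eq[OF h] by metis
  qed
next
  assume *: "\<forall>u v. opair u v \<in> elts h \<longrightarrow> v = check_name c u \<and> (\<forall>b\<in>elts u. opair b (check_name c b) \<in> elts h)"
  show "check_map c h"
    unfolding check_map_def
  proof (intro allI impI)
    fix u v assume "opair u v \<in> elts h"
    then have v: "v = check_name c u" and b: "\<forall>b\<in>elts u. opair b (check_name c b) \<in> elts h" using * by auto
    show "(\<forall>a\<in>elts v. \<exists>b\<in>elts u. \<exists>d. a = opair d c \<and> opair b d \<in> elts h) \<and>
     (\<forall>b\<in>elts u. \<exists>d. opair b d \<in> elts h \<and> opair d c \<in> elts v)"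
      using b unfolding v elts_check_name by blast
  qed
qed

context zf_model begin

lemma definable_check_map:
  assumes "defterm h" "c \<in> V" shows "definable (\<lambda>e. check_map c (h e))"
proof (rule definable_cong)
  fix e assume e: "env e"
  have *: "x \<in> V \<and> y \<in> V" if "opair x y \<in> elts (h e)" for x y
    using opair_elts_V[OF that defterm_V[OF assms(1) e]] .
  show "check_map c (h e) \<longleftrightarrow> (\<forall>u\<in>V. \<forall>v\<in>V. opair u v \<in> elts (h e) \<longrightarrow>
     (\<forall>a\<in>elts v. \<exists>b\<in>elts u. \<exists>d\<in>V. a = opair d c \<and> opair b d \<in> elts (h e)) \<and>
     (\<forall>b\<in>elts u. \<exists>d\<in>V. opair b d \<in> elts (h e) \<and> opair d c \<in> elts v))"
  proof -
    have 1: "(\<exists>d. R d \<and> opair b d \<in> elts (h e)) \<longleftrightarrow> (\<exists>d\<in>V. R d \<and> opair b d \<in> elts (h e))" for R b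
      using * by blast
    have 2: "(\<exists>d. opair b d \<in> elts (h e) \<and> R d) \<longleftrightarrow> (\<exists>d\<in>V. opair b d \<in> elts (h e) \<and> R d)" for R b
      using * by blast
    have 3: "(\<forall>u v. opair u v \<in> elts (h e) \<longrightarrow> R u v) \<longleftrightarrow>
        (\<forall>u\<in>V. \<forall>v\<in>V. opair u v \<in> elts (h e) \<longrightarrow> R u v)" for R
      using * by blast
    show ?thesis unfolding check_map_def 1 2 3 ..
  qed
next
  show "definable (\<lambda>e. \<forall>u\<in>V. \<forall>v\<in>V. opair u v \<in> elts (h e) \<longrightarrow>
     (\<forall>a\<in>elts v. \<exists>b\<in>elts u. \<exists>d\<in>V. a = opair d c \<and> opair b d \<in> elts (h e)) \<and>
     (\<forall>b\<in>elts u. \<exists>d\<in>V. opair b d \<in> elts (h e) \<and> opair d c \<in> elts v))"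
    by (intro definable_intros defclass_V defterm_const assms definable_shift_intros)
qed

text \<open>
  By \<open>\<in>\<close>-induction. For each element \<open>y\<close> of \<open>x\<close> there is an attempt defined at \<open>y\<close>. In order to
  collect these attempts by replacement one of them must be singled out: attempts are closed under
  intersection, so there is a least one. The union of the least attempts is an attempt, and it extends
  to \<open>x\<close>.
\<close>

lemma check_map_exists:
  assumes c: "c \<in> V" and "x \<in> V"
  shows "\<exists>h\<in>V. check_map c h \<and> x \<in> dom_of h"
  using assms(2)
proof (induction x rule: wf_induct_rule[OF wf_mem_rel])
  case (1 x)
  let ?R = "\<lambda>y h. check_map c h \<and> y \<in> dom_of h"
  have IH: "\<exists>h\<in>V. ?R y h" if "y \<in> elts x" for y
    using 1 that trans_V by (auto simp: mem_rel_def)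
  define least where "least y h \<longleftrightarrow> ?R y h \<and> (\<forall>g\<in>V. ?R y g \<longrightarrow> elts h \<subseteq> elts g)" for y h
  have "\<exists>h\<in>V. least y h" if y: "y \<in> elts x" for y
  proof -
    obtain h where h: "h \<in> V" "?R y h" using IH[OF y] by blast
    have "coded {z \<in> elts h. \<forall>g\<in>V. ?R y g \<longrightarrow> z \<in> elts g}"
    proof (rule separation)
      show "definable (\<lambda>e. \<forall>g\<in>V. ?R y g \<longrightarrow> e 0 \<in> elts g)"
        by (intro definable_check_map definable_intros defclass_V defclass_dom_of defterm_const trans_V[OF y] 1(2) c definable_shift_intros)
    qed (simp add: h)
    then obtain h' where h': "h' \<in> V" "elts h' = {z \<in> elts h. \<forall>g\<in>V. ?R y g \<longrightarrow> z \<in> elts g}"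
      by (auto simp: coded_def)
    then have mem: "z \<in> elts h' \<longleftrightarrow> (\<forall>g\<in>V. ?R y g \<longrightarrow> z \<in> elts g)" for z using h by blast
    have "check_map c h'"
      using h h' unfolding check_map_iff by auto
    moreover have "opair y (check_name c y) \<in> elts h'"
      unfolding mem check_map_iff dom_of_def by blast
    then have "y \<in> dom_of h'" by (auto simp: dom_of_def)
    ultimately have "least y h'" unfolding least_def using mem by blast
    then show ?thesis using h' by blast
  qed
  then obtain f where f: "\<And>y. y \<in> elts x \<Longrightarrow> f y \<in> V \<and> least y (f y)" by metis
  have uniq: "h = f y" if "y \<in> elts x" "h \<in> V" "least y h" for y h
    using f[OF that(1)] that unfolding least_def by (metis elts_eq_iff subset_antisym)
  have "coded (f ` elts x)"
  proof (rule replacement)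
    show "definable (\<lambda>e. least (e 0) (e 1))"
      unfolding least_def
      by (intro definable_check_map definable_intros defclass_V defclass_dom_of c definable_shift_intros)
  qed (use 1(2) f uniq in auto)
  then have "coded (\<Union>h\<in>f ` elts x. elts h)" by (rule coded_Union)
  then obtain U where U: "U \<in> V" "elts U = (\<Union>y\<in>elts x. elts (f y))" by (auto simp: coded_def)
  have gU: "check_map c U"
    unfolding check_map_iff
  proof (intro allI impI)
    fix u v assume "opair u v \<in> elts U"
    then obtain y where y: "y \<in> elts x" "opair u v \<in> elts (f y)" by (auto simp: U)
    then have "check_map c (f y)" "elts (f y) \<subseteq> elts U" using f U by (auto simp: least_def)
    then show "v = check_name c u \<and> (\<forall>b\<in>elts u. opair b (check_name c b) \<in> elts U)"
      using y(2) unfolding check_map_iff by blast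
  qed
  have mU: "opair y (check_name c y) \<in> elts U" if y: "y \<in> elts x" for y
  proof -
    obtain d where "opair y d \<in> elts (f y)" using f[OF y] by (auto simp: least_def dom_of_def)
    then have "opair y d \<in> elts U" using y U by auto
    then show ?thesis using gU unfolding check_map_iff by blast
  qed
  have "coded ((\<lambda>y. opair (check_name c y) c) ` elts x)"
  proof (rule replacement)
    show "definable (\<lambda>e. \<exists>d\<in>V. e 1 = opair d c \<and> opair (e 0) d \<in> elts U)"
      by (intro definable_intros defclass_V defterm_const U c definable_shift_intros)
    fix y z assume "y \<in> elts x" "z \<in> V"
    then show "(\<exists>d\<in>V. z = opair d c \<and> opair y d \<in> elts U) \<longleftrightarrow> z = opair (check_name c y) c"
      using mU check_map_eq[OF gU] opair_elts_V[OF _ U(1)] by blast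
  qed (use mU opair_elts_V[OF _ U(1)] c 1(2) in auto)
  then have chkx: "check_name c x \<in> V" by (subst check_name.simps) (rule coded_set_of)
  have "coded (insert (opair x (check_name c x)) (elts U))"
    by (intro coded_insert coded_elts opair_V chkx 1(2) U(1))
  then obtain h where h: "h \<in> V" "elts h = insert (opair x (check_name c x)) (elts U)"
    by (auto simp: coded_def)
  have "check_map c h"
    using gU mU unfolding check_map_iff h(2) by auto
  moreover have "x \<in> dom_of h" by (auto simp: dom_of_def h)
  ultimately show ?case using h by blast
qed

lemma check_name_iff:
  assumes "c \<in> V" "x \<in> V"
  shows "v = check_name c x \<longleftrightarrow> (\<exists>h\<in>V. check_map c h \<and> opair x v \<in> elts h)"
  using check_map_exists[OF assms] check_map_eq unfolding dom_of_def by blast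

lemma check_name_V: "c \<in> V \<Longrightarrow> x \<in> V \<Longrightarrow> check_name c x \<in> V"
  using check_name_iff opair_elts_V by blast

lemma defterm_check_name:
  assumes "c \<in> V" "defterm t" shows "defterm (\<lambda>e. check_name c (t e))"
  unfolding defterm_def
proof (intro conjI allI impI)
  have "definable (\<lambda>e. \<exists>h\<in>V. check_map c h \<and> opair (t (tl_env e)) (e 0) \<in> elts h)"
    by (intro definable_check_map definable_intros defclass_V assms definable_shift_intros)
  then show "definable (\<lambda>e. e 0 = check_name c (t (tl_env e)))"
    by (rule definable_cong[rotated]) (rule check_name_iff[OF assms(1) defterm_V[OF assms(2)]], simp)
qed (use assms check_name_V defterm_V in blast)

end

lemma nval_elts: "elts (nval G \<tau>) = nval G ` {\<sigma>. \<exists>p\<in>G. opair \<sigma> p \<in> elts \<tau>}"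
proof -
  have "countable {\<sigma>. \<exists>p\<in>G. opair \<sigma> p \<in> elts \<tau>}"
  proof (rule countable_subset)
    show "{\<sigma>. \<exists>p\<in>G. opair \<sigma> p \<in> elts \<tau>} \<subseteq> (\<lambda>z. SOME \<sigma>. \<exists>p. z = opair \<sigma> p) ` elts \<tau>"
      by (force intro!: rev_image_eqI)
  qed (simp add: countable_elts)
  then show ?thesis by (subst nval.simps) (simp add: elts_set_of)
qed

lemma pname_check_name: "c \<in> P \<Longrightarrow> pname P (check_name c x)"
proof (induction x rule: wf_induct_rule[OF wf_mem_rel])
  case (1 x)
  then show ?case by (intro pname.intros) (auto simp: elts_check_name mem_rel_def)
qed

lemma nval_check_name: "c \<in> G \<Longrightarrow> nval G (check_name c x) = x"
proof (induction x rule: wf_induct_rule[OF wf_mem_rel])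
  case (1 x)
  have "{\<sigma>. \<exists>p\<in>G. opair \<sigma> p \<in> elts (check_name c x)} = check_name c ` elts x"
    using 1(2) by (auto simp: elts_check_name)
  then have "elts (nval G (check_name c x)) = elts x"
    using 1 by (auto simp: nval_elts mem_rel_def image_image)
  then show ?case by (simp add: elts_eq_iff)
qed

section \<open>Trees of finite height\<close>

text \<open>
  A tree of height \<open>n\<close> may be given any finite set of new top nodes, as long as every old top node gets
  a successor.
\<close>

lemma ntree_extend:
  assumes A: "ntree n A" and B: "finite B" "\<And>l. l \<in> B \<Longrightarrow> length l = Suc n \<and> butlast l \<in> A"
    and top: "\<And>l. l \<in> A \<Longrightarrow> length l = n \<Longrightarrow> \<exists>k. l @ [k] \<in> B"
  shows "ntree (Suc n) (A \<union> B)"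
proof -
  have A': "ltree A" "\<And>l. l \<in> A \<Longrightarrow> length l \<le> n" "\<And>l. l \<in> A \<Longrightarrow> length l < n \<Longrightarrow> splits A l"
    using A by (auto simp: ntree_def)
  have "ltree (A \<union> B)"
    unfolding ltree_def
  proof (intro conjI allI impI)
    show "A \<union> B \<noteq> {}" using A' by (auto simp: ltree_def)
    fix l r assume "l @ r \<in> A \<union> B"
    moreover have "l \<in> A" if "l @ r \<in> A" for r using A' that by (auto simp: ltree_def)
    ultimately show "l \<in> A \<union> B"
      using B(2)[of "l @ r"] by (cases r rule: rev_cases) (auto simp: butlast_append)
  qed
  moreover have "splits (A \<union> B) l" if l: "l \<in> A \<union> B" "length l < Suc n" for l
  proof -
    have lA: "l \<in> A" using l B(2)[of l] by auto
    show ?thesis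
    proof (cases "length l = n")
      case True
      have "finite {k. l @ [k] \<in> B}"
        using finite_vimageI[OF B(1), of "\<lambda>k. l @ [k]"] by (simp add: inj_on_def vimage_def)
      moreover have "{k. l @ [k] \<in> A} = {}" using A'(2) True by fastforce
      ultimately show ?thesis using top[OF lA True] by (auto simp: splits_def)
    next
      case False
      then have "{k. l @ [k] \<in> B} = {}" using B(2) by fastforce
      then show ?thesis using A'(3)[OF lA] False l by (auto simp: splits_def)
    qed
  qed
  moreover have "length l \<le> Suc n" if "l \<in> A \<union> B" for l
    using that A'(2)[of l] B(2)[of l] by auto
  ultimately show ?thesis by (auto simp: ntree_def)
qed

lemma ntree_generated:
  assumes "finite H" "H \<noteq> {}"
  shows "ntree n {map g [0..<m] | g m. g \<in> H \<and> m \<le> n}"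
proof (induction n)
  case 0
  have "{map g [0..<m] | g m. g \<in> H \<and> m \<le> 0} = {[]}" using assms(2) by auto
  then show ?case by (auto simp: ntree_def ltree_def)
next
  case (Suc n)
  have "{map g [0..<m] | g m. g \<in> H \<and> m \<le> Suc n}
     = {map g [0..<m] | g m. g \<in> H \<and> m \<le> n} \<union> (\<lambda>g. map g [0..<Suc n]) ` H"
    by (auto simp: le_Suc_eq image_iff simp del: upt_Suc)
  moreover have "ntree (Suc n) \<dots>"
  proof (rule ntree_extend[OF Suc])
    fix l assume "l \<in> (\<lambda>g. map g [0..<Suc n]) ` H"
    then obtain g where "g \<in> H" "l = map g [0..<Suc n]" by blast
    then show "length l = Suc n \<and> butlast l \<in> {map g [0..<m] | g m. g \<in> H \<and> m \<le> n}"
      by (simp add: butlast_append) blast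
  next
    fix l assume "l \<in> {map g [0..<m] | g m. g \<in> H \<and> m \<le> n}" "length l = n"
    then obtain g where "g \<in> H" "l = map g [0..<n]" by auto
    then show "\<exists>k. l @ [k] \<in> (\<lambda>g. map g [0..<Suc n]) ` H" by force
  qed (use assms in auto)
  ultimately show ?case by simp
qed

lemma finite_bound: "finite X \<Longrightarrow> \<exists>M. \<forall>x\<in>X. (f x :: nat) < M"
  using finite_nat_set_iff_bounded[of "f ` X"] by auto

text \<open>
  The label \<open>K\<close> of the new top nodes is left free; it is later chosen so as to avoid finitely many
  given nodes.
\<close>

definition grow :: "nat \<Rightarrow> nat \<Rightarrow> (nat \<Rightarrow> nat) set \<Rightarrow> nat list set \<Rightarrow> nat list set" where
  "grow n K H A = A \<union> ((\<lambda>l. l @ [K]) ` {l \<in> A. length l = n} \<union> (\<lambda>g. map g [0..<Suc n]) ` H)"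

lemma ntree_grow:
  assumes "ntree n A" "finite H" "\<And>g. g \<in> H \<Longrightarrow> map g [0..<n] \<in> A"
  shows "ntree (Suc n) (grow n K H A)"
  unfolding grow_def
  by (rule ntree_extend[OF assms(1)]) (use assms ntree_finite in auto)

lemma grow_below: "length l \<le> n \<Longrightarrow> l \<in> grow n K H A \<longleftrightarrow> l \<in> A"
  by (auto simp: grow_def)

lemma grow_top: 
  assumes "ntree n A" "length l = Suc n"
  shows "l \<in> grow n K H A \<longleftrightarrow> (\<exists>l'\<in>A. length l' = n \<and> l = l' @ [K]) \<or> (\<exists>g\<in>H. l = map g [0..<Suc n])"
proof -
  have "l \<notin> A" using assms by (auto simp: ntree_def)
  then show ?thesis by (auto simp: grow_def)
qed

section \<open>Conditions as finite data\<close>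

text \<open>
  The condition without promises that is given by the index set \<open>F\<close>, the height \<open>n\<close> and the trees \<open>A i\<close>.
\<close>

definition tree_part :: "nat set \<Rightarrow> nat \<Rightarrow> (nat \<Rightarrow> nat list set) \<Rightarrow> hc" where
  "tree_part F n A = set_of {opair (opair (num i) (enc l)) (num (if l \<in> A i then 1 else 0)) | i l.
     i \<in> F \<and> length l \<le> n}"

lemma elts_tree_part:
  "elts (tree_part F n A) = {opair (opair (num i) (enc l)) (num (if l \<in> A i then 1 else 0)) | i l.
     i \<in> F \<and> length l \<le> n}"
  unfolding tree_part_def
proof (rule elts_set_of)
  show "countable {opair (opair (num i) (enc l)) (num (if l \<in> A i then 1 else 0)) | i l.
     i \<in> F \<and> length l \<le> n}"
  proof (rule countable_subset)
    let ?t = "\<lambda>x. opair (opair (num (fst x)) (enc (snd x))) (num (if snd x \<in> A (fst x) then 1 else 0))"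
    show "{opair (opair (num i) (enc l)) (num (if l \<in> A i then 1 else 0)) | i l. i \<in> F \<and> length l \<le> n}
      \<subseteq> range ?t"
    proof
      fix z assume "z \<in> {opair (opair (num i) (enc l)) (num (if l \<in> A i then 1 else 0)) | i l.
        i \<in> F \<and> length l \<le> n}"
      then obtain i l where "z = ?t (i, l)" by auto
      then show "z \<in> range ?t" by blast
    qed
  qed simp
qed

lemma cond_tree_of_tree_part: 
  assumes "\<forall>l\<in>A i. length l \<le> n"
  shows "cond_tree (tree_part F n A) (num i) = (if i \<in> F then enc ` A i else {})"
  using assms by (auto simp: cond_tree_def elts_tree_part split: if_splits)

lemma is_func_tree_part: "is_func (tree_part F n A)"
  by (auto simp: is_func_def elts_tree_part)

text \<open>
  The reals that must be branches of the \<open>i\<close>-th tree.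
\<close>

definition promised :: "hc \<Rightarrow> nat \<Rightarrow> (nat \<Rightarrow> nat) set" where
  "promised w i = rfun ` {f. opair f (num i) \<in> elts w}"

lemma restr_baire:
  assumes "f \<in> baire" shows "restr f n = enc (map (rfun f) [0..<n])"
proof -
  have f: "is_func f" "dom_of f = range num" "ran_of f \<subseteq> range num" using assms by (auto simp: baire_def)
  have "{z \<in> elts f. \<exists>x\<in>elts (num n). \<exists>y. z = opair x y} = {opair (num i) (num (rfun f i)) | i. i < n}"
  proof (intro set_eqI iffI)
    fix z assume "z \<in> {z \<in> elts f. \<exists>x\<in>elts (num n). \<exists>y. z = opair x y}"
    then obtain i y where z: "z \<in> elts f" "i < n" "z = opair (num i) y" by (auto simp: elts_num)
    then have "y \<in> ran_of f" by (auto simp: ran_of_def)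
    then obtain k where "y = num k" using f by blast
    then show "z \<in> {opair (num i) (num (rfun f i)) | i. i < n}"
      using z rfun_eq[OF f(1)] by auto
  next
    fix z assume "z \<in> {opair (num i) (num (rfun f i)) | i. i < n}"
    then show "z \<in> {z \<in> elts f. \<exists>x\<in>elts (num n). \<exists>y. z = opair x y}"
      using rfun_mem[OF f(1) _ f(3)] f(2) by (auto simp: elts_num)
  qed
  then have "elts (restr f n) = elts (enc (map (rfun f) [0..<n]))"
    unfolding restr_def by (auto simp: elts_enc elts_set_of countable_finite)
  then show ?thesis by (simp add: elts_eq_iff)
qed

lemma rfun_inj: 
  assumes "f \<in> baire" "f' \<in> baire" "rfun f = rfun f'" shows "f = f'"
proof -
  have "elts f \<subseteq> elts f'" if "f \<in> baire" "f' \<in> baire" "rfun f = rfun f'" for f f'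
  proof
    fix z assume z: "z \<in> elts f"
    have f: "is_func f" "dom_of f = range num" "ran_of f \<subseteq> range num" 
      and f': "is_func f'" "dom_of f' = range num" "ran_of f' \<subseteq> range num" 
      using that by (auto simp: baire_def)
    obtain x y where "z = opair x y" using is_func_pair[OF f(1) z] by blast
    moreover from this z have "x \<in> range num" "y \<in> range num" using f by (auto simp: dom_of_def ran_of_def)
    ultimately obtain i k where "z = opair (num i) (num k)" by blast
    then show "z \<in> elts f'" 
      using rfun_eq[OF f(1), of i k] z rfun_mem[OF f'(1) _ f'(3), of i] f'(2) that(3) by auto
  qed
  from this[OF assms] this[OF assms(2,1) assms(3)[symmetric]] show ?thesis
    by (simp add: elts_eq_iff[symmetric])
qed

lemma ltree_take: "ltree A \<Longrightarrow> l \<in> A \<Longrightarrow> take m l \<in> A"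
  unfolding ltree_def by (metis append_take_drop_id)

context zf_model begin

lemma coded_Diff: assumes "coded X" "coded Y" shows "coded (X - Y)"
proof -
  obtain y where y: "y \<in> V" "elts y = Y" using assms by (auto simp: coded_def)
  have "coded {x \<in> X. x \<notin> elts y}"
    by (intro separation assms definable_intros defterm_const y)
  then show ?thesis using y by (simp add: set_diff_eq)
qed

lemma coded_Seq_le: "coded (\<Union>m\<le>n. seqs m)"
proof -
  obtain e where e: "env e" using ex_env by blast
  show ?thesis by (rule separation_defclass[OF defclass_Seq_le[OF natterm_const] e _ coded_Seq]) auto
qed

text \<open>
  Although the domain of the condition is infinite, it belongs to \<open>V\<close>: the arguments with value 1 form a
  finite set, and the others are obtained from it by complementation in a product.
\<close>

lemma tree_cond_tree_part:
  assumes F: "finite F" and A: "\<And>i. i \<in> F \<Longrightarrow> ntree n (A i)"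
  shows "tree_cond V (num ` F) n (tree_part F n A)"
proof -
  let ?ones = "{opair (num i) (enc l) | i l. i \<in> F \<and> l \<in> A i}"
  let ?D = "opairs (num ` F) (\<Union>m\<le>n. seqs m)"
  have len: "length l \<le> n" if "i \<in> F" "l \<in> A i" for i l using A that by (auto simp: ntree_def)
  have "?ones = (\<Union>i\<in>F. (\<lambda>l. opair (num i) (enc l)) ` A i)" by auto
  then have "finite ?ones" using F by (auto intro: ntree_finite[OF A])
  then have "coded ?ones" by (rule coded_finite) auto
  moreover have "elts (tree_part F n A) = opairs ?ones {num 1} \<union> opairs (?D - ?ones) {num 0}"
  proof (intro set_eqI iffI)
    fix z assume "z \<in> elts (tree_part F n A)"
    then obtain i l where z: "i \<in> F" "length l \<le> n"
      "z = opair (opair (num i) (enc l)) (num (if l \<in> A i then 1 else 0))"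
      by (auto simp: elts_tree_part)
    then show "z \<in> opairs ?ones {num 1} \<union> opairs (?D - ?ones) {num 0}"
      by (cases "l \<in> A i") (auto simp: opairs_def UN_seqs)
  next
    fix z assume "z \<in> opairs ?ones {num 1} \<union> opairs (?D - ?ones) {num 0}"
    then consider i l where "i \<in> F" "l \<in> A i" "z = opair (opair (num i) (enc l)) (num 1)"
      | i l where "i \<in> F" "length l \<le> n" "l \<notin> A i" "z = opair (opair (num i) (enc l)) (num 0)"
      by (auto simp: opairs_def UN_seqs)
    then show "z \<in> elts (tree_part F n A)"
      by cases (use len in \<open>force simp: elts_tree_part\<close>)+
  qed
  moreover have "coded (num ` F)" using F by (intro coded_finite) auto
  ultimately have "coded (elts (tree_part F n A))"
    by (metis (no_types, lifting) coded_Un coded_opairs coded_Diff coded_Seq_le coded_finite finite.intros num_V insert_subset empty_subsetI)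
  then have "tree_part F n A \<in> V" by (metis set_of_elts coded_set_of)
  moreover have "fs_ntree V n (cond_tree (tree_part F n A) (num i))" if "i \<in> F" for i
    using A[OF that] that by (simp add: cond_tree_of_tree_part ntree_def[of n "A i"] fs_ntree_enc)
  moreover have "dom_of (tree_part F n A) = {opair i s | i s. i \<in> num ` F \<and> s \<in> (\<Union>m\<le>n. seqs m)}"
    by (auto simp: dom_of_def elts_tree_part UN_seqs)
  moreover have "ran_of (tree_part F n A) \<subseteq> {num 0, num 1}"
    by (auto simp: ran_of_def elts_tree_part)
  moreover have "finite_in V (num ` F)" using F by (auto simp: finite_in_iff)
  ultimately show ?thesis unfolding tree_cond_def using is_func_tree_part by blast
qed

lemma tree_cond_obtain:
  assumes "tree_cond V F' n p"
  obtains F A where "F' = num ` F" "finite F" "\<And>i. i \<in> F \<Longrightarrow> ntree n (A i)" "p = tree_part F n A"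
proof -
  have p: "F' \<subseteq> range num" "finite F'" "is_func p" "ran_of p \<subseteq> {num 0, num 1}"
    "dom_of p = {opair i s | i s. i \<in> F' \<and> s \<in> (\<Union>m\<le>n. seqs m)}"
    "\<And>i. i \<in> F' \<Longrightarrow> fs_ntree V n (cond_tree p i)"
    using assms unfolding tree_cond_def finite_in_iff by blast+
  define F where "F = num -` F'"
  have F: "F' = num ` F" "finite F"
    using p(1,2) by (auto simp: F_def inj_num finite_vimageI)
  define A where "A i = enc -` cond_tree p (num i)" for i
  have A: "ntree n (A i)" "cond_tree p (num i) = enc ` A i" if "i \<in> F" for i
  proof -
    obtain B where B: "cond_tree p (num i) = enc ` B" "ntree n B"
      using p(6)[of "num i"] \<open>i \<in> F\<close> F by (auto elim: fs_ntree_obtain)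
    then have "A i = B" by (auto simp: A_def)
    then show "ntree n (A i)" "cond_tree p (num i) = enc ` A i" using B by auto
  qed
  have "elts p = elts (tree_part F n A)"
  proof (intro set_eqI iffI)
    fix z assume z: "z \<in> elts p"
    obtain x y where xy: "z = opair x y" using is_func_pair[OF p(3) z] by blast
    then have "x \<in> dom_of p" "y \<in> ran_of p" using z by (auto simp: dom_of_def ran_of_def)
    then obtain i l where il: "i \<in> F" "length l \<le> n" "x = opair (num i) (enc l)" "y = num 0 \<or> y = num 1"
      using p(4,5) F by (auto simp: UN_seqs)
    moreover have "l \<in> A i \<longleftrightarrow> y = num 1"
    proof -
      have "l \<in> A i \<longleftrightarrow> opair x (num 1) \<in> elts p" by (simp add: A_def cond_tree_def il)
      then show ?thesis using z xy is_func_unique[OF p(3)] by blast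
    qed
    ultimately show "z \<in> elts (tree_part F n A)" unfolding elts_tree_part xy by auto
  next
    fix z assume "z \<in> elts (tree_part F n A)"
    then obtain i l where il: "i \<in> F" "length l \<le> n"
      "z = opair (opair (num i) (enc l)) (num (if l \<in> A i then 1 else 0))"
      by (auto simp: elts_tree_part)
    then have "opair (num i) (enc l) \<in> dom_of p" using p(5) F by (auto simp: UN_seqs)
    then obtain y where y: "opair (opair (num i) (enc l)) y \<in> elts p" by (auto simp: dom_of_def)
    then have "y \<in> ran_of p" by (auto simp: ran_of_def)
    then have "y = num 0 \<or> y = num 1" using p(4) by blast
    moreover have "l \<in> A i \<longleftrightarrow> opair (opair (num i) (enc l)) (num 1) \<in> elts p" 
      by (simp add: A_def cond_tree_def)
    then have "l \<in> A i \<longleftrightarrow> y = num 1" using y is_func_unique[OF p(3)] by blast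
    ultimately show "z \<in> elts p" using y il(3) by auto
  qed
  then show ?thesis using that[OF F A(1)] by (simp add: elts_eq_iff)
qed

definition is_cond :: "hc \<Rightarrow> nat set \<Rightarrow> nat \<Rightarrow> (nat \<Rightarrow> nat list set) \<Rightarrow> hc \<Rightarrow> bool" where
  "is_cond \<T> F n A w \<longleftrightarrow> finite F \<and> (\<forall>i\<in>F. ntree n (A i)) \<and> side_cond V \<T> w \<and>
     (\<forall>i\<in>F. \<forall>g\<in>promised w i. map g [0..<n] \<in> A i)"

lemma side_cond_baire: "side_cond V \<T> w \<Longrightarrow> opair f i \<in> elts w \<Longrightarrow> f \<in> baire \<inter> W_reals V \<T>"
  unfolding side_cond_def W_reals_def dom_of_def by blast

lemma promised_below:
  assumes "side_cond V \<T> w" "\<forall>l\<in>A i. length l \<le> n" "i \<in> F"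
  shows "(\<forall>g\<in>promised w i. map g [0..<n] \<in> A i) \<longleftrightarrow>
    (\<forall>f. opair f (num i) \<in> elts w \<longrightarrow> restr f n \<in> cond_tree (tree_part F n A) (num i))"
  using side_cond_baire[OF assms(1)] assms(3)
  by (auto simp: promised_def cond_tree_of_tree_part[where A = A and i = i, OF assms(2)] restr_baire)

text \<open>
  From here on conditions are treated as data of the logic: finite index sets, heights and sets of
  lists.
\<close>

lemma mem_tree_forcing_iff:
  "c \<in> tree_forcing V \<T> \<longleftrightarrow> (\<exists>F n A w. c = opair (tree_part F n A) w \<and> is_cond \<T> F n A w)"
proof
  assume "c \<in> tree_forcing V \<T>"
  then obtain p w F' n where c: "c = opair p w" "tree_cond V F' n p" "side_cond V \<T> w"
    "\<forall>f i. opair f i \<in> elts w \<longrightarrow> i \<notin> F' \<or> restr f n \<in> cond_tree p i"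
    unfolding tree_forcing_def by blast
  obtain F A where FA: "F' = num ` F" "finite F" "\<And>i. i \<in> F \<Longrightarrow> ntree n (A i)" "p = tree_part F n A"
    using tree_cond_obtain[OF c(2)] by blast
  have "\<forall>g\<in>promised w i. map g [0..<n] \<in> A i" if "i \<in> F" for i
    by (subst promised_below[OF c(3)]) (use that FA c(4) in \<open>auto simp: ntree_def\<close>)
  then show "\<exists>F n A w. c = opair (tree_part F n A) w \<and> is_cond \<T> F n A w"
    by (intro exI[of _ F] exI[of _ n] exI[of _ A] exI[of _ w]) (simp add: is_cond_def c(1,3) FA)
next
  assume "\<exists>F n A w. c = opair (tree_part F n A) w \<and> is_cond \<T> F n A w"
  then obtain F n A w where c: "c = opair (tree_part F n A) w" "is_cond \<T> F n A w" by blast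
  then have F: "finite F" "\<And>i. i \<in> F \<Longrightarrow> ntree n (A i)" and w: "side_cond V \<T> w"
    and pr: "\<And>i. i \<in> F \<Longrightarrow> \<forall>g\<in>promised w i. map g [0..<n] \<in> A i"
    by (auto simp: is_cond_def)
  have "i \<notin> num ` F \<or> restr f n \<in> cond_tree (tree_part F n A) i" if "opair f i \<in> elts w" for f i
  proof (rule disjCI)
    assume "\<not> restr f n \<in> cond_tree (tree_part F n A) i"
    show "i \<notin> num ` F"
    proof
      assume "i \<in> num ` F"
      then obtain j where j: "i = num j" "j \<in> F" by blast
      then have "restr f n \<in> cond_tree (tree_part F n A) i"
        using pr[OF j(2)] F(2)[OF j(2)] that promised_below[OF w, of A j n F] by (auto simp: ntree_def)
      then show False using \<open>\<not> _\<close> by blast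
    qed
  qed
  moreover have "tree_cond V (num ` F) n (tree_part F n A)" using F by (rule tree_cond_tree_part)
  ultimately show "c \<in> tree_forcing V \<T>"
    unfolding tree_forcing_def c(1) using w by blast
qed

lemma finite_promised: 
  assumes "side_cond V \<T> w" shows "finite (promised w i)"
proof -
  have "{f. opair f (num i) \<in> elts w} \<subseteq> dom_of w" by (auto simp: dom_of_def)
  moreover have "finite (dom_of w)" using assms by (simp add: side_cond_def finite_in_iff)
  ultimately show ?thesis unfolding promised_def using finite_subset by blast
qed

text \<open>
  The side condition is a function, and a real is determined by its values.
\<close>

lemma promised_disjoint:
  assumes "side_cond V \<T> w" "g \<in> promised w i" "g \<in> promised w j" shows "i = j"
proof -
  obtain f f' where f: "opair f (num i) \<in> elts w" "opair f' (num j) \<in> elts w" "g = rfun f" "g = rfun f'"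
    using assms(2,3) by (auto simp: promised_def)
  then have "f = f'" using side_cond_baire[OF assms(1)] by (intro rfun_inj) auto
  moreover have "is_func w" using assms(1) by (simp add: side_cond_def)
  ultimately have "num i = num j" using f is_func_unique by blast
  then show ?thesis by simp
qed

text \<open>
  The domain of a side condition consists of reals that are not branches of any tree of the family.
\<close>

lemma promised_avoids:
  assumes "side_cond V \<T> w" "g \<in> promised w i" "T \<in> elts \<T>" "elts T = enc ` B"
  shows "\<exists>n. map g [0..<n] \<notin> B"
proof -
  obtain f where f: "opair f (num i) \<in> elts w" "g = rfun f" using assms(2) by (auto simp: promised_def)
  then have "f \<in> baire" "f \<notin> branches (elts T)"
    using side_cond_baire[OF assms(1) f(1)] assms(3) by (auto simp: W_reals_def)
  then obtain n where "restr f n \<notin> elts T" by (auto simp: branches_def)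
  then have "map g [0..<n] \<notin> B" using assms(4) f(2) restr_baire[OF \<open>f \<in> baire\<close>] by auto
  then show ?thesis by blast
qed

section \<open>Extending conditions\<close>

text \<open>
  End-extension: the trees that are already present stay the same up to height \<open>n\<close>.
\<close>

definition extends :: "nat set \<Rightarrow> nat \<Rightarrow> (nat \<Rightarrow> nat list set) \<Rightarrow> nat set \<Rightarrow> nat \<Rightarrow> (nat \<Rightarrow> nat list set) \<Rightarrow> bool" where
  "extends F' n' A' F n A \<longleftrightarrow> F \<subseteq> F' \<and> n \<le> n' \<and> (\<forall>i\<in>F. \<forall>l. length l \<le> n \<longrightarrow> l \<in> A' i \<longleftrightarrow> l \<in> A i)"

lemma extends_le: "extends F' n' A' F n A \<Longrightarrow> forcing_le (opair (tree_part F' n' A') w) (opair (tree_part F n A) w)"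
  unfolding forcing_le_def
proof (intro exI conjI)
  assume "extends F' n' A' F n A"
  then show "elts (tree_part F n A) \<subseteq> elts (tree_part F' n' A')"
    unfolding extends_def elts_tree_part by fastforce
qed auto

lemma extends_trans: 
  "extends F'' n'' A'' F' n' A' \<Longrightarrow> extends F' n' A' F n A \<Longrightarrow> extends F'' n'' A'' F n A"
  unfolding extends_def by (auto simp: subset_iff)

lemma extends_refl: "extends F n A F n A"
  by (simp add: extends_def)

text \<open>
  A new tree needs the initial segments of its promised reals; the zero sequence is included for the case
  that nothing is promised.
\<close>

lemma cond_add:
  assumes "is_cond \<T> F n A w"
  shows "\<exists>A'. is_cond \<T> (insert i F) n A' w \<and> extends (insert i F) n A' F n A"
proof (cases "i \<in> F")
  case True
  then show ?thesis using assms extends_refl by (metis insert_absorb)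
next
  case False
  let ?H = "insert (\<lambda>_. 0) (promised w i)"
  let ?A = "A(i := {map g [0..<m] | g m. g \<in> ?H \<and> m \<le> n})"
  have "ntree n (?A i)"
    using ntree_generated[of ?H n] finite_promised assms by (auto simp: is_cond_def)
  moreover have "map g [0..<n] \<in> ?A i" if "g \<in> promised w i" for g
    using that by auto
  ultimately have "is_cond \<T> (insert i F) n ?A w"
    using assms unfolding is_cond_def by auto
  moreover have "extends (insert i F) n ?A F n A" using False by (auto simp: extends_def)
  ultimately show ?thesis by blast
qed

lemma cond_grow:
  fixes K :: nat
  assumes "is_cond \<T> F n A w"
  defines "A' \<equiv> \<lambda>i. grow n (K + i) (promised w i) (A i)"
  shows "is_cond \<T> F (Suc n) A' w" "extends F (Suc n) A' F n A"
proof -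
  have "ntree (Suc n) (A' i)" if "i \<in> F" for i
    unfolding A'_def using assms(1) that finite_promised by (intro ntree_grow) (auto simp: is_cond_def)
  moreover have "map g [0..<Suc n] \<in> A' i" if "g \<in> promised w i" for g i
    using that unfolding A'_def grow_def by blast
  ultimately show "is_cond \<T> F (Suc n) A' w" using assms(1) unfolding is_cond_def by blast
  show "extends F (Suc n) A' F n A" by (simp add: extends_def A'_def grow_below)
qed

lemma cond_reach:
  assumes "is_cond \<T> F n A w"
  shows "\<exists>n' A'. m \<le> n' \<and> is_cond \<T> F n' A' w \<and> extends F n' A' F n A"
proof (induction m)
  case 0 then show ?case using assms extends_refl by blast
next
  case (Suc m)
  then obtain n' A' where "m \<le> n'" "is_cond \<T> F n' A' w" "extends F n' A' F n A" by blast
  then show ?case using cond_grow[of \<T> F n' A' w 0] extends_trans by (meson Suc_le_mono)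
qed

text \<open>
  After the height where all reals promised to \<open>i\<close> have left \<open>T\<close>, one level with large labels
  suffices.
\<close>

lemma cond_avoid_tree:
  assumes "is_cond \<T> F n A w" and T: "T \<in> elts \<T>" "elts T = enc ` B" "ltree B" "\<forall>l\<in>B. splits B l"
  shows "\<exists>F' n' A'. is_cond \<T> F' n' A' w \<and> extends F' n' A' F n A \<and> i \<in> F' \<and>
    (\<forall>l. length l = n' \<longrightarrow> \<not> (l \<in> A' i \<and> l \<in> B))"
proof -
  have w: "side_cond V \<T> w" using assms(1) by (simp add: is_cond_def)
  let ?F = "insert i F"
  obtain A1 where A1: "is_cond \<T> ?F n A1 w" "extends ?F n A1 F n A" using cond_add[OF assms(1)] by blast
  have "\<exists>N. \<forall>g\<in>promised w i. map g [0..<N] \<notin> B"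
  proof -
    obtain N where N: "\<And>g. g \<in> promised w i \<Longrightarrow> map g [0..<N g] \<notin> B"
      using promised_avoids[OF w _ T(1,2)] by metis
    obtain M where M: "\<forall>g\<in>promised w i. N g < M"
      using finite_bound[OF finite_promised[OF w, of i], of N] by blast
    have "map g [0..<M] \<notin> B" if "g \<in> promised w i" for g
    proof
      assume "map g [0..<M] \<in> B"
      then have "take (N g) (map g [0..<M]) \<in> B" by (rule ltree_take[OF T(3)])
      then show False using N M that by (simp add: take_map less_imp_le)
    qed
    then show ?thesis by blast
  qed
  then obtain N where N: "\<And>g. g \<in> promised w i \<Longrightarrow> map g [0..<N] \<notin> B" by blast
  obtain n' A2 where A2: "N \<le> n'" "is_cond \<T> ?F n' A2 w" "extends ?F n' A2 ?F n A1"
    using cond_reach[OF A1(1)] by blast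
  \<comment> \<open>The labels on the next level of \<open>T\<close> are bounded, so \<open>K + i\<close> is none of them.\<close>
  have "finite (last ` {l \<in> B. length l = Suc n'})"
    using ltree_level_finite[OF T(3)] T(4) by auto
  then obtain K where K: "\<And>l. l \<in> B \<Longrightarrow> length l = Suc n' \<Longrightarrow> last l < K"
    by (auto simp: finite_nat_set_iff_bounded)
  let ?A = "\<lambda>i. grow n' (K + i) (promised w i) (A2 i)"
  have "\<not> (l \<in> ?A i \<and> l \<in> B)" if l: "length l = Suc n'" for l
  proof
    assume *: "l \<in> ?A i \<and> l \<in> B"
    have "ntree n' (A2 i)" using A2 by (auto simp: is_cond_def)
    then consider l' where "l = l' @ [K + i]" | g where "g \<in> promised w i" "l = map g [0..<Suc n']"
      using * grow_top[OF _ l] by blast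
    then show False
    proof cases
      case 1
      then show False using K[of l] * l by simp
    next
      case (2 g)
      then have "take N l = map g [0..<N]" using A2(1) by (simp add: take_map)
      then show False using ltree_take[OF T(3), of l N] * N 2 by simp
    qed
  qed
  then show ?thesis
    using cond_grow(1)[OF A2(2), of K] extends_trans[OF extends_trans[OF cond_grow(2)[OF A2(2), of K] A2(3)] A1(2)]
    by (intro exI[of _ ?F] exI[of _ "Suc n'"] exI[of _ ?A]) simp
qed

lemma finite_separate:
  fixes H :: "(nat \<Rightarrow> nat) set"
  assumes "finite H"
  shows "\<exists>N. \<forall>g\<in>H. \<forall>h\<in>H. g \<noteq> h \<longrightarrow> map g [0..<N] \<noteq> map h [0..<N]"
proof -
  define d where "d x = (SOME k. fst x k \<noteq> snd x k)" for x :: "(nat \<Rightarrow> nat) \<times> (nat \<Rightarrow> nat)"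
  have d: "g (d (g, h)) \<noteq> h (d (g, h))" if "g \<noteq> h" for g h
  proof -
    have "\<exists>k. g k \<noteq> h k" using that by blast
    then show ?thesis unfolding d_def fst_conv snd_conv by (rule someI_ex)
  qed
  obtain M where M: "\<forall>x\<in>H \<times> H. d x < M"
    using finite_bound[of "H \<times> H" d] assms by auto
  have "map g [0..<M] \<noteq> map h [0..<M]" if "g \<in> H" "h \<in> H" "g \<noteq> h" for g h
  proof
    assume "map g [0..<M] = map h [0..<M]"
    then have "g i = h i" if "i < M" for i using that by (simp add: map_eq_conv)
    then show False using d[OF that(3)] M that by auto
  qed
  then show ?thesis by blast
qed

text \<open>
  A common node on the new level could arise in three ways: both labels are \<open>K + i\<close> and \<open>K + j\<close>, which
  differ; one is a value of a promised real, which is below \<open>K\<close>; or both nodes are on promised reals,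
  which have separated.
\<close>

lemma cond_separate:
  assumes "is_cond \<T> F n A w" "i \<noteq> j"
  shows "\<exists>F' n' A'. is_cond \<T> F' n' A' w \<and> extends F' n' A' F n A \<and> i \<in> F' \<and> j \<in> F' \<and>
    (\<forall>l. length l = n' \<longrightarrow> \<not> (l \<in> A' i \<and> l \<in> A' j))"
proof -
  have w: "side_cond V \<T> w" using assms(1) by (simp add: is_cond_def)
  let ?F = "insert j (insert i F)"
  let ?H = "promised w i \<union> promised w j"
  have fH: "finite ?H" using finite_promised[OF w] by blast
  obtain A0 where A0: "is_cond \<T> (insert i F) n A0 w" "extends (insert i F) n A0 F n A"
    using cond_add[OF assms(1)] by blast
  obtain A1 where "is_cond \<T> ?F n A1 w" "extends ?F n A1 (insert i F) n A0"
    using cond_add[OF A0(1)] by blast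
  then have A1: "is_cond \<T> ?F n A1 w" "extends ?F n A1 F n A"
    using extends_trans A0(2) by blast+
  obtain N where N: "\<forall>g\<in>?H. \<forall>h\<in>?H. g \<noteq> h \<longrightarrow> map g [0..<N] \<noteq> map h [0..<N]"
    using finite_separate[OF fH] by blast
  obtain n' A2 where A2: "N \<le> n'" "is_cond \<T> ?F n' A2 w" "extends ?F n' A2 ?F n A1"
    using cond_reach[OF A1(1)] by blast
  obtain K where K: "\<forall>g\<in>?H. g n' < K"
    using finite_bound[OF fH, of "\<lambda>g. g n'"] by blast
  let ?A = "\<lambda>i. grow n' (K + i) (promised w i) (A2 i)"
  have "\<not> (l \<in> ?A i \<and> l \<in> ?A j)" if l: "length l = Suc n'" for l
  proof
    assume *: "l \<in> ?A i \<and> l \<in> ?A j"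
    have "ntree n' (A2 i)" "ntree n' (A2 j)" using A2 by (auto simp: is_cond_def)
    then have i: "last l = K + i \<or> (\<exists>g\<in>promised w i. l = map g [0..<Suc n'])"
      and j: "last l = K + j \<or> (\<exists>g\<in>promised w j. l = map g [0..<Suc n'])"
      using * grow_top[OF _ l] by auto
    have small: "last l < K" if "g \<in> ?H" "l = map g [0..<Suc n']" for g
      using K that by simp
    then obtain g h where g: "g \<in> promised w i" "l = map g [0..<Suc n']"
       and h: "h \<in> promised w j" "l = map h [0..<Suc n']"
      using i j assms(2) by (metis Un_iff add_left_cancel not_add_less1)
    then have "take N l = map g [0..<N]" "take N l = map h [0..<N]"
      using A2(1) by (simp_all add: take_map)
    then have "g = h" using N g(1) h(1) by (metis Un_iff)
    then show False using promised_disjoint[OF w] g h assms(2) by blast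
  qed
  then show ?thesis
    using cond_grow(1)[OF A2(2), of K] extends_trans[OF extends_trans[OF cond_grow(2)[OF A2(2), of K] A2(3)] A1(2)]
    by (intro exI[of _ ?F] exI[of _ "Suc n'"] exI[of _ ?A]) simp
qed

end

section \<open>The generic trees\<close>

locale tree_generic = zf_model +
  fixes \<T> :: hc and G :: "hc set"
  assumes T_in_V: "\<T> \<in> V" and adfs_T: "adfs V \<T>"
    and generic: "generic_filter V (tree_forcing V \<T>) forcing_le G"
begin

abbreviation "P \<equiv> tree_forcing V \<T>"

lemma G_subset: "G \<subseteq> P" and G_nonempty: "G \<noteq> {}"
  and G_upward: "p \<in> G \<Longrightarrow> q \<in> P \<Longrightarrow> forcing_le p q \<Longrightarrow> q \<in> G"
  and G_directed: "p \<in> G \<Longrightarrow> q \<in> G \<Longrightarrow> \<exists>r\<in>G. forcing_le r p \<and> forcing_le r q"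
  using generic unfolding generic_filter_def filter_on_def by blast+

lemma P_V: "P \<subseteq> V"
  using coded_V coded_tree_forcing[OF T_in_V] by blast

text \<open>
  Genericity for definable properties: it is enough to find the required extensions among conditions
  given as data.
\<close>

lemma meets_dense:
  assumes "definable (\<lambda>e. Q (e 0))" 
    and "\<And>F n A w. is_cond \<T> F n A w \<Longrightarrow>
      \<exists>F' n' A'. is_cond \<T> F' n' A' w \<and> extends F' n' A' F n A \<and> Q (opair (tree_part F' n' A') w)"
  shows "\<exists>F n A w. opair (tree_part F n A) w \<in> G \<and> is_cond \<T> F n A w \<and> Q (opair (tree_part F n A) w)"
proof -
  have "coded {c \<in> P. Q c}" by (rule separation[OF coded_tree_forcing[OF T_in_V] assms(1)])
  then obtain D where D: "D \<in> V" "elts D = {c \<in> P. Q c}" by (auto simp: coded_def)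
  have "dense_in P forcing_le (elts D)"
    unfolding dense_in_def
  proof (intro conjI ballI)
    fix c assume "c \<in> P"
    then obtain F n A w where c: "c = opair (tree_part F n A) w" "is_cond \<T> F n A w"
      unfolding mem_tree_forcing_iff by blast
    obtain F' n' A' where *: "is_cond \<T> F' n' A' w" "extends F' n' A' F n A" "Q (opair (tree_part F' n' A') w)"
      using assms(2)[OF c(2)] by blast
    have "opair (tree_part F' n' A') w \<in> P" unfolding mem_tree_forcing_iff using *(1) by blast
    then show "\<exists>q\<in>elts D. forcing_le q c"
      using * extends_le D(2) c(1) by (intro bexI[of _ "opair (tree_part F' n' A') w"]) auto
  qed (use D in auto)
  then have "G \<inter> elts D \<noteq> {}" using generic D(1) unfolding generic_filter_def by blast
  then obtain c where "c \<in> G" "c \<in> P" "Q c" using D(2) by blast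
  then show ?thesis unfolding mem_tree_forcing_iff by blast
qed

definition gtree :: "nat \<Rightarrow> nat list set" where
  "gtree i = {l. \<exists>p w. opair p w \<in> G \<and> enc l \<in> cond_tree p (num i)}"

lemma elts_generic_tree: "elts (generic_tree G i) = enc ` gtree i"
proof -
  have "{s \<in> (\<Union>n. seqs n). \<exists>p w. opair p w \<in> G \<and> s \<in> cond_tree p (num i)} = enc ` gtree i"
    by (auto simp: UN_seqs gtree_def)
  moreover have "countable (enc ` gtree i)" by auto
  ultimately show ?thesis unfolding generic_tree_def by (simp add: elts_set_of)
qed

lemma enc_mem_cond_tree: 
  assumes "is_cond \<T> F n A w"
  shows "enc l \<in> cond_tree (tree_part F n A) (num i) \<longleftrightarrow> i \<in> F \<and> l \<in> A i"
proof (cases "i \<in> F")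
  case True
  then have "\<forall>l\<in>A i. length l \<le> n" using assms by (auto simp: is_cond_def ntree_def)
  then show ?thesis using True by (auto simp: cond_tree_of_tree_part)
next
  case False
  then show ?thesis by (auto simp: cond_tree_def elts_tree_part)
qed

lemma cond_lengths: "is_cond \<T> F n A w \<Longrightarrow> i \<in> F \<Longrightarrow> l \<in> A i \<Longrightarrow> length l \<le> n"
  by (auto simp: is_cond_def ntree_def)

text \<open>
  If some condition in the filter puts a node into the tree, then so does a common extension with the given
  condition. The latter already decides all nodes of length at most \<open>n\<close>, and a condition is a
  function.
\<close>

lemma gtree_below:
  assumes "opair (tree_part F n A) w \<in> G" "is_cond \<T> F n A w" "i \<in> F" "length l \<le> n"
  shows "l \<in> gtree i \<longleftrightarrow> l \<in> A i"
proof
  assume "l \<in> A i"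
  then show "l \<in> gtree i" unfolding gtree_def using assms enc_mem_cond_tree by blast
next
  assume "l \<in> gtree i"
  then obtain q v where q: "opair q v \<in> G" "enc l \<in> cond_tree q (num i)" by (auto simp: gtree_def)
  obtain r where r: "r \<in> G" "forcing_le r (opair q v)" "forcing_le r (opair (tree_part F n A) w)"
    using G_directed[OF q(1) assms(1)] by blast
  then obtain p u where p: "r = opair p u" "elts q \<subseteq> elts p" "elts (tree_part F n A) \<subseteq> elts p"
    unfolding forcing_le_def by auto
  have "r \<in> P" using r(1) G_subset by blast
  then have "is_func p" using p(1) unfolding tree_forcing_def tree_cond_def by auto
  moreover have "opair (opair (num i) (enc l)) (num 1) \<in> elts p"
    using q(2) p(2) by (auto simp: cond_tree_def)
  moreover have "opair (opair (num i) (enc l)) (num (if l \<in> A i then 1 else 0)) \<in> elts (tree_part F n A)"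
    using assms(3,4) unfolding elts_tree_part by blast
  then have "opair (opair (num i) (enc l)) (num (if l \<in> A i then 1 else 0)) \<in> elts p"
    using p(3) by blast
  ultimately have "num (if l \<in> A i then 1 else 0) = num 1" by (metis is_func_unique)
  then show "l \<in> A i" by (auto split: if_splits)
qed

lemma definable_has_node:
  assumes "defterm c" "defterm s" 
  shows "definable (\<lambda>e. \<exists>p\<in>V. \<exists>w\<in>V. c e = opair p w \<and> s e \<in> cond_tree p (num i))"
  by (intro definable_intros defclass_cond_tree defclass_V assms definable_shift_intros)

abbreviation has_node :: "hc \<Rightarrow> nat \<Rightarrow> hc \<Rightarrow> bool" where
  "has_node c i s \<equiv> \<exists>p\<in>V. \<exists>w\<in>V. c = opair p w \<and> s \<in> cond_tree p (num i)"

lemma has_node_iff: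
  assumes "is_cond \<T> F n A w"
  shows "has_node (opair (tree_part F n A) w) i (enc l) \<longleftrightarrow> i \<in> F \<and> l \<in> A i"
proof -
  have "opair (tree_part F n A) w \<in> V" using assms mem_tree_forcing_iff P_V by blast
  then show ?thesis using enc_mem_cond_tree[OF assms] by auto
qed

text \<open>
  The dense set says that the \<open>i\<close>-th tree has a node of length \<open>m\<close>. As trees of height \<open>n\<close> have nodes of
  all lengths up to \<open>n\<close> and no others, this expresses that the height is at least \<open>m\<close>.
\<close>

lemma G_reaches:
  "\<exists>F n A w. opair (tree_part F n A) w \<in> G \<and> is_cond \<T> F n A w \<and> i \<in> F \<and> m \<le> n"
proof -
  have "\<exists>F n A w. opair (tree_part F n A) w \<in> G \<and> is_cond \<T> F n A w \<and>
     (\<exists>s\<in>seqs m. has_node (opair (tree_part F n A) w) i s)"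
  proof (rule meets_dense[of "\<lambda>c. \<exists>s\<in>seqs m. has_node c i s"])
    show "definable (\<lambda>e. \<exists>s\<in>seqs m. has_node (e 0) i s)"
      by (intro definable_has_node definable_bex defclass_seqs natterm_const defterm_var defterm_tl_env)
    fix F n A w assume g: "is_cond \<T> F n A w"
    obtain A1 where A1: "is_cond \<T> (insert i F) n A1 w" "extends (insert i F) n A1 F n A"
      using cond_add[OF g] by blast
    obtain n' A' where A': "m \<le> n'" "is_cond \<T> (insert i F) n' A' w" "extends (insert i F) n' A' (insert i F) n A1"
      using cond_reach[OF A1(1)] by blast
    obtain l where "l \<in> A' i" "length l = m"
      using ntree_level_nonempty[of n' "A' i" m] A' by (auto simp: is_cond_def)
    then have "\<exists>s\<in>seqs m. has_node (opair (tree_part (insert i F) n' A') w) i s"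
      using has_node_iff[OF A'(2), where i = i and l = l] by (auto simp: seqs_eq)
    then show "\<exists>F' n' A'. is_cond \<T> F' n' A' w \<and> extends F' n' A' F n A \<and>
      (\<exists>s\<in>seqs m. has_node (opair (tree_part F' n' A') w) i s)"
      using A'(2) extends_trans[OF A'(3) A1(2)]
      by (intro exI[of _ "insert i F"] exI[of _ n'] exI[of _ A']) blast
  qed
  then obtain F n A w where *: "opair (tree_part F n A) w \<in> G" "is_cond \<T> F n A w"
    "\<exists>s\<in>seqs m. has_node (opair (tree_part F n A) w) i s" by blast
  then obtain l where "length l = m" "i \<in> F" "l \<in> A i"
    using has_node_iff[OF *(2)] by (auto simp: seqs_eq)
  then show ?thesis using * cond_lengths by blast
qed

lemma ltree_gtree: "ltree (gtree i)"
  unfolding ltree_def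
proof (intro conjI allI impI)
  obtain F n A w where *: "opair (tree_part F n A) w \<in> G" "is_cond \<T> F n A w" "i \<in> F" using G_reaches by blast
  then have "[] \<in> A i" by (auto simp: is_cond_def ntree_def ltree_Nil)
  then show "gtree i \<noteq> {}" using gtree_below[OF *, of "[]"] by auto
next
  fix l r assume "l @ r \<in> gtree i"
  moreover obtain F n A w where *: "opair (tree_part F n A) w \<in> G" "is_cond \<T> F n A w" "i \<in> F" "length (l @ r) \<le> n"
    using G_reaches by blast
  ultimately have "l @ r \<in> A i" using gtree_below by blast
  then have "l \<in> A i" using *(2,3) unfolding is_cond_def ntree_def ltree_def by blast
  then show "l \<in> gtree i" using gtree_below[OF *(1-3), of l] *(4) by simp
qed

lemma splits_gtree: assumes "l \<in> gtree i" shows "splits (gtree i) l"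
proof -
  obtain F n A w where *: "opair (tree_part F n A) w \<in> G" "is_cond \<T> F n A w" "i \<in> F" "Suc (length l) \<le> n"
    using G_reaches by blast
  have "l \<in> A i" using gtree_below[OF *(1-3), of l] *(4) assms by simp
  then have "splits (A i) l" using *(2-4) by (auto simp: is_cond_def ntree_def)
  moreover have "l @ [k] \<in> gtree i \<longleftrightarrow> l @ [k] \<in> A i" for k
    using gtree_below[OF *(1-3), of "l @ [k]"] *(4) by simp
  ultimately show ?thesis by (simp add: splits_def)
qed

text \<open>
  The set of all levels serves as a parameter in the dense sets below; the height of a condition is then
  recovered as a level that the tree reaches.
\<close>

lemma coded_levels: "coded (range (\<lambda>n. set_of (seqs n)))"
proof -
  obtain e where e: "env e" using ex_env by blast
  have "coded (seqs n)" for n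
    by (rule separation_defclass[OF defclass_seqs[OF natterm_const] e _ coded_Seq]) auto
  have defterm: "defterm (\<lambda>e. set_of (seqs (unnum (e 0))))"
    by (intro defterm_set_of defclass_seqs natterm_unnum defterm_var) (rule \<open>coded (seqs _)\<close>)
  have "coded ((\<lambda>x. set_of (seqs (unnum x))) ` range num)"
  proof (rule replacement)
    show "definable (\<lambda>e. e 1 = set_of (seqs (unnum (e 0))))" by (intro definable_eq defterm defterm_var)
  qed (use coded_omega coded_set_of \<open>\<And>n. coded (seqs n)\<close> in auto)
  then show ?thesis by (simp add: image_image)
qed

lemma finite_meet:
  assumes "ltree B" "\<forall>l\<in>B. splits B l" "ltree C" "\<forall>l. length l = n \<longrightarrow> \<not> (l \<in> C \<and> l \<in> B)"
  shows "finite (C \<inter> B)"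
proof (rule finite_subset)
  show "C \<inter> B \<subseteq> {l \<in> B. length l \<le> n}"
  proof
    fix l assume l: "l \<in> C \<inter> B"
    have "length l \<le> n"
    proof (rule ccontr)
      assume "\<not> length l \<le> n"
      then have "length (take n l) = n" by simp
      then show False using assms(4) ltree_take[OF assms(1)] ltree_take[OF assms(3)] l by blast
    qed
    then show "l \<in> {l \<in> B. length l \<le> n}" using l by blast
  qed
  show "finite {l \<in> B. length l \<le> n}" using ltree_levels_finite[OF assms(1)] assms(2) by blast
qed

text \<open>
  The dense set requires a level that the \<open>i\<close>-th tree reaches and on which it misses \<open>T\<close>. That it is
  reached guarantees that the condition decides the generic tree on this level.
\<close>

lemma gtree_ground:
  assumes T: "T \<in> elts \<T>" "elts T = enc ` B" "ltree B" "\<forall>l\<in>B. splits B l"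
  shows "finite (gtree i \<inter> B)"
proof -
  let ?Q = "\<lambda>c. \<exists>X\<in>range (\<lambda>n. set_of (seqs n)). (\<exists>s\<in>elts X. has_node c i s) \<and>
    (\<forall>s\<in>elts X. \<not> (has_node c i s \<and> s \<in> elts T))"
  obtain L where L: "L \<in> V" "elts L = range (\<lambda>n. set_of (seqs n))"
    using coded_levels by (auto simp: coded_def)
  have TV: "T \<in> V" using T T_in_V trans_V by blast
  have el: "elts (set_of (seqs n)) = seqs n" for n by (rule elts_set_of) (auto simp: seqs_eq)
  have "\<exists>F n A w. opair (tree_part F n A) w \<in> G \<and> is_cond \<T> F n A w \<and> ?Q (opair (tree_part F n A) w)"
  proof (rule meets_dense[of ?Q])
    show "definable (\<lambda>e. ?Q (e 0))"
      unfolding L(2)[symmetric]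
      by (intro definable_has_node definable_bex definable_conj definable_ball definable_not definable_in defterm_var defterm_const L(1) TV defclass_elts defterm_tl_env)
    fix F n A w assume "is_cond \<T> F n A w"
    then obtain F' n' A' where *: "is_cond \<T> F' n' A' w" "extends F' n' A' F n A" "i \<in> F'"
      "\<forall>l. length l = n' \<longrightarrow> \<not> (l \<in> A' i \<and> l \<in> B)"
      using cond_avoid_tree[OF _ T] by blast
    obtain l where "l \<in> A' i" "length l = n'"
      using ntree_level_nonempty[of n' "A' i" n'] * by (auto simp: is_cond_def)
    then have "\<exists>s\<in>seqs n'. has_node (opair (tree_part F' n' A') w) i s"
      using has_node_iff[OF *(1), where i = i and l = l] *(3) by (auto simp: seqs_eq)
    moreover have "\<forall>s\<in>seqs n'. \<not> (has_node (opair (tree_part F' n' A') w) i s \<and> s \<in> elts T)"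
      using has_node_iff[OF *(1), where i = i] *(4) T(2) by (auto simp: seqs_eq)
    ultimately have "?Q (opair (tree_part F' n' A') w)"
      by (intro bexI[of _ "set_of (seqs n')"]) (simp_all only: el, auto)
    then show "\<exists>F' n' A'. is_cond \<T> F' n' A' w \<and> extends F' n' A' F n A \<and> ?Q (opair (tree_part F' n' A') w)"
      using *(1,2) by (intro exI[of _ F'] exI[of _ n'] exI[of _ A']) blast
  qed
  then obtain F n A w X where *: "opair (tree_part F n A) w \<in> G" "is_cond \<T> F n A w"
    "X \<in> range (\<lambda>n. set_of (seqs n))"
    "\<exists>s\<in>elts X. has_node (opair (tree_part F n A) w) i s"
    "\<forall>s\<in>elts X. \<not> (has_node (opair (tree_part F n A) w) i s \<and> s \<in> elts T)"
    by blast
  obtain N where N: "elts X = enc ` {l. length l = N}" using *(3) el seqs_eq by auto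
  obtain l where "length l = N" "i \<in> F" "l \<in> A i" using *(4) has_node_iff[OF *(2)] N by auto
  then have i: "i \<in> F" "N \<le> n" using cond_lengths[OF *(2)] by auto
  have "\<not> (l \<in> gtree i \<and> l \<in> B)" if l: "length l = N" for l
  proof -
    have "enc l \<in> elts X" using l N by simp
    then have "\<not> (l \<in> A i \<and> l \<in> B)" using *(5) has_node_iff[OF *(2)] i(1) T(2) by blast
    then show ?thesis using gtree_below[OF *(1,2) i(1), of l] l i(2) by blast
  qed
  then show ?thesis using finite_meet[OF T(3,4) ltree_gtree] by blast
qed

lemma gtree_gtree:
  assumes "i \<noteq> j" shows "finite (gtree i \<inter> gtree j)"
proof -
  let ?Q = "\<lambda>c. \<exists>X\<in>range (\<lambda>n. set_of (seqs n)). (\<exists>s\<in>elts X. has_node c i s) \<and> (\<exists>s\<in>elts X. has_node c j s) \<and>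
    (\<forall>s\<in>elts X. \<not> (has_node c i s \<and> has_node c j s))"
  obtain L where L: "L \<in> V" "elts L = range (\<lambda>n. set_of (seqs n))"
    using coded_levels by (auto simp: coded_def)
  have el: "elts (set_of (seqs n)) = seqs n" for n by (rule elts_set_of) (auto simp: seqs_eq)
  have "\<exists>F n A w. opair (tree_part F n A) w \<in> G \<and> is_cond \<T> F n A w \<and> ?Q (opair (tree_part F n A) w)"
  proof (rule meets_dense[of ?Q])
    show "definable (\<lambda>e. ?Q (e 0))"
      unfolding L(2)[symmetric]
      by (intro definable_has_node definable_bex definable_conj definable_ball definable_not defterm_var defterm_const L(1) defclass_elts defterm_tl_env)
    fix F n A w assume "is_cond \<T> F n A w"
    then obtain F' n' A' where *: "is_cond \<T> F' n' A' w" "extends F' n' A' F n A" "i \<in> F'" "j \<in> F'"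
      "\<forall>l. length l = n' \<longrightarrow> \<not> (l \<in> A' i \<and> l \<in> A' j)"
      using cond_separate[OF _ assms] by blast
    have "\<exists>s\<in>seqs n'. has_node (opair (tree_part F' n' A') w) k s" if k: "k \<in> F'" for k
    proof -
      obtain l where "l \<in> A' k" "length l = n'"
        using ntree_level_nonempty[of n' "A' k" n'] * k by (auto simp: is_cond_def)
      then show ?thesis using has_node_iff[OF *(1), where i = k and l = l] k by (auto simp: seqs_eq)
    qed
    moreover have "\<forall>s\<in>seqs n'. \<not> (has_node (opair (tree_part F' n' A') w) i s \<and> has_node (opair (tree_part F' n' A') w) j s)"
      using has_node_iff[OF *(1)] *(5) unfolding seqs_eq by blast
    ultimately have "?Q (opair (tree_part F' n' A') w)"
      using *(3,4) by (intro bexI[of _ "set_of (seqs n')"]) (simp_all only: el, auto)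
    then show "\<exists>F' n' A'. is_cond \<T> F' n' A' w \<and> extends F' n' A' F n A \<and> ?Q (opair (tree_part F' n' A') w)"
      using *(1,2) by (intro exI[of _ F'] exI[of _ n'] exI[of _ A']) blast
  qed
  then obtain F n A w X where *: "opair (tree_part F n A) w \<in> G" "is_cond \<T> F n A w"
    "X \<in> range (\<lambda>n. set_of (seqs n))"
    "\<exists>s\<in>elts X. has_node (opair (tree_part F n A) w) i s"
    "\<exists>s\<in>elts X. has_node (opair (tree_part F n A) w) j s"
    "\<forall>s\<in>elts X. \<not> (has_node (opair (tree_part F n A) w) i s \<and> has_node (opair (tree_part F n A) w) j s)"
    by blast
  obtain N where N: "elts X = enc ` {l. length l = N}" using *(3) el seqs_eq by auto
  obtain l where "length l = N" "i \<in> F" "l \<in> A i" using *(4) has_node_iff[OF *(2)] N by auto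
  then have i: "i \<in> F" "N \<le> n" using cond_lengths[OF *(2)] by auto
  have j: "j \<in> F" using *(5) has_node_iff[OF *(2)] N by auto
  have "\<not> (l \<in> gtree i \<and> l \<in> gtree j)" if l: "length l = N" for l
  proof -
    have "enc l \<in> elts X" using l N by simp
    then have "\<not> (l \<in> A i \<and> l \<in> A j)" using *(6) has_node_iff[OF *(2)] i(1) j by blast
    then show ?thesis using gtree_below[OF *(1,2)] i j l by blast
  qed
  then show ?thesis
    using finite_meet[OF ltree_gtree _ ltree_gtree, of j N i] splits_gtree by blast
qed

section \<open>Names for the family\<close>

text \<open>
  The weakest condition, the pair of two empty functions.
\<close>

definition "top_cond = opair (tree_part {} 0 (\<lambda>_. {})) (set_of {})"

lemma top_cond_P: "top_cond \<in> P"
proof -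
  have "is_cond \<T> {} 0 (\<lambda>_. {}) (set_of {})"
    by (auto simp: is_cond_def side_cond_def is_func_def dom_of_def ran_of_def elts_set_of finite_in_iff
        intro: coded_set_of coded_empty)
  then show ?thesis unfolding top_cond_def mem_tree_forcing_iff by blast
qed

lemma top_cond_G: "top_cond \<in> G"
proof -
  obtain c where c: "c \<in> G" using G_nonempty by blast
  then obtain p w where "c = opair p w" using G_subset unfolding tree_forcing_def by blast
  then have "forcing_le c top_cond"
    unfolding forcing_le_def top_cond_def by (auto simp: elts_tree_part elts_set_of)
  then show ?thesis using G_upward c top_cond_P by blast
qed

lemma top_cond_V: "top_cond \<in> V" using top_cond_P P_V by blast

abbreviation "VG \<equiv> generic_ext V P G"

lemma ground_subset: "V \<subseteq> VG"
proof
  fix x assume "x \<in> V"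
  then show "x \<in> VG"
    unfolding generic_ext_def using check_name_V[OF top_cond_V] pname_check_name[OF top_cond_P] nval_check_name[OF top_cond_G] 
    by (metis (mono_tags, lifting) mem_Collect_eq)
qed

text \<open>
  A name for the generic tree with number \<open>x\<close>: the check name of a node is put into it by the
  conditions that have this node.
\<close>

definition gname :: "hc \<Rightarrow> hc" where
  "gname x = set_of {z. \<exists>s\<in>\<Union>n. seqs n. \<exists>c\<in>P. has_node c (unnum x) s \<and> z = opair (check_name top_cond s) c}"

lemma coded_gname: "coded {z. \<exists>s\<in>\<Union>n. seqs n. \<exists>c\<in>P. has_node c (unnum x) s \<and> z = opair (check_name top_cond s) c}"
  and defterm_gname: "defterm (\<lambda>e. gname (e 0))"
proof -
  have ch: "check_name top_cond s \<in> V" if "s \<in> seqs n" for s n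
    using that check_name_V[OF top_cond_V] seqs_V by blast
  have *: "defclass (\<lambda>e. {z. \<exists>s\<in>\<Union>n. seqs n. \<exists>c\<in>P. (\<exists>p\<in>V. \<exists>w\<in>V. c = opair p w \<and> s \<in> cond_tree p (num (unnum (e 0)))) \<and>
      z = opair (check_name top_cond s) c})"
  proof (rule defclass_Collect)
    show "definable (\<lambda>e. \<exists>s\<in>\<Union>n. seqs n. \<exists>c\<in>P. 
      (\<exists>p\<in>V. \<exists>w\<in>V. c = opair p w \<and> s \<in> cond_tree p (num (unnum (tl_env e 0)))) \<and> e 0 = opair (check_name top_cond s) c)"
      by (intro definable_bex definable_conj definable_eq definable_in defclass_Seq defclass_V defclass_tree_forcing[OF T_in_V] 
          defterm_opair defterm_check_name top_cond_V defclass_cond_tree natterm_unnum defterm_var defterm_tl_env)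
  qed (use ch P_V in auto)
  have c: "coded (check_name top_cond ` (\<Union>n. seqs n))"
  proof (rule replacement[OF coded_Seq])
    show "definable (\<lambda>e. e 1 = check_name top_cond (e 0))" by (intro definable_eq defterm_check_name defterm_var top_cond_V)
  qed (use ch in auto)
  have v: "coded {z. \<exists>s\<in>\<Union>n. seqs n. \<exists>c\<in>P. (\<exists>p\<in>V. \<exists>w\<in>V. c = opair p w \<and> s \<in> cond_tree p (num (unnum (e 0)))) \<and>
      z = opair (check_name top_cond s) c}" if "env e" for e
  proof (rule separation_defclass[OF * that _ coded_opairs[OF c coded_tree_forcing[OF T_in_V]]])
    show "{z. \<exists>s\<in>\<Union>n. seqs n. \<exists>c\<in>P. (\<exists>p\<in>V. \<exists>w\<in>V. c = opair p w \<and> s \<in> cond_tree p (num (unnum (e 0)))) \<and>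
      z = opair (check_name top_cond s) c} \<subseteq> opairs (check_name top_cond ` (\<Union>n. seqs n)) P"
      unfolding opairs_def by blast
  qed
  show "defterm (\<lambda>e. gname (e 0))" unfolding gname_def by (rule defterm_set_of[OF *]) (rule v)
  have "env (\<lambda>_. num (unnum x))" by (simp add: env_def)
  from v[OF this] show "coded {z. \<exists>s\<in>\<Union>n. seqs n. \<exists>c\<in>P. has_node c (unnum x) s \<and> z = opair (check_name top_cond s) c}"
    by simp
qed

lemma elts_gname:
  "elts (gname x) = {z. \<exists>s\<in>\<Union>n. seqs n. \<exists>c\<in>P. has_node c (unnum x) s \<and> z = opair (check_name top_cond s) c}"
  unfolding gname_def by (rule coded_elts_set_of[OF coded_gname])

lemma pname_gname: "pname P (gname x)"
  by (rule pname.intros) (use pname_check_name[OF top_cond_P] in \<open>auto simp: elts_gname\<close>)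

lemma nval_gname: "nval G (gname (num i)) = generic_tree G i"
proof -
  have "{\<sigma>. \<exists>p\<in>G. opair \<sigma> p \<in> elts (gname (num i))} = check_name top_cond ` enc ` gtree i"
  proof (intro set_eqI iffI)
    fix \<sigma> assume "\<sigma> \<in> {\<sigma>. \<exists>p\<in>G. opair \<sigma> p \<in> elts (gname (num i))}"
    then obtain s c where "s \<in> (\<Union>n. seqs n)" "c \<in> G" "has_node c i s" "\<sigma> = check_name top_cond s"
      unfolding elts_gname by auto
    then show "\<sigma> \<in> check_name top_cond ` enc ` gtree i" by (auto simp: UN_seqs gtree_def)
  next
    fix \<sigma> assume "\<sigma> \<in> check_name top_cond ` enc ` gtree i"
    then obtain l p w where *: "\<sigma> = check_name top_cond (enc l)" "opair p w \<in> G" "enc l \<in> cond_tree p (num i)"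
      by (auto simp: gtree_def)
    moreover have "opair p w \<in> P" "opair p w \<in> V" using *(2) G_subset P_V by blast+
    moreover have "enc l \<in> (\<Union>n. seqs n)" by (simp add: UN_seqs)
    ultimately have "opair \<sigma> (opair p w) \<in> elts (gname (num i))"
      unfolding elts_gname by auto
    then show "\<sigma> \<in> {\<sigma>. \<exists>p\<in>G. opair \<sigma> p \<in> elts (gname (num i))}" using *(2) by blast
  qed
  then have "elts (nval G (gname (num i))) = elts (generic_tree G i)"
    by (simp add: nval_elts elts_generic_tree image_image nval_check_name[OF top_cond_G])
  then show ?thesis by (simp add: elts_eq_iff)
qed

text \<open>
  The name consists of the check name of the old family and of the names of the generic trees, all with
  the weakest condition.
\<close>

lemma family_in_VG: "set_of (elts \<T> \<union> generic_trees G) \<in> VG"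
proof -
  have gV: "gname x \<in> V" for x
    unfolding gname_def by (rule coded_set_of[OF coded_gname])
  have "coded ((\<lambda>x. opair (gname x) top_cond) ` range num)"
  proof (rule replacement[OF coded_omega])
    show "definable (\<lambda>e. e 1 = opair (gname (e 0)) top_cond)"
      by (intro definable_eq defterm_opair defterm_gname defterm_const defterm_var top_cond_V)
  qed (use gV top_cond_V in auto)
  then have v: "coded (elts (check_name top_cond \<T>) \<union> (\<lambda>x. opair (gname x) top_cond) ` range num)"
    by (intro coded_Un coded_elts check_name_V top_cond_V T_in_V)
  define \<tau> where "\<tau> = set_of (elts (check_name top_cond \<T>) \<union> (\<lambda>x. opair (gname x) top_cond) ` range num)"
  have \<tau>: "\<tau> \<in> V" "elts \<tau> = elts (check_name top_cond \<T>) \<union> (\<lambda>x. opair (gname x) top_cond) ` range num"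
    unfolding \<tau>_def using v coded_set_of coded_elts_set_of by blast+
  have "pname P \<tau>"
    by (rule pname.intros) (use pname_check_name[OF top_cond_P] pname_gname top_cond_P in \<open>auto simp: \<tau>(2) elts_check_name\<close>)
  moreover have "nval G \<tau> = set_of (elts \<T> \<union> generic_trees G)"
  proof -
    have "{\<sigma>. \<exists>p\<in>G. opair \<sigma> p \<in> elts \<tau>} = check_name top_cond ` elts \<T> \<union> gname ` range num"
      using top_cond_G by (auto simp: \<tau>(2) elts_check_name)
    then have "elts (nval G \<tau>) = elts \<T> \<union> generic_trees G"
      by (simp add: nval_elts image_Un image_image nval_check_name[OF top_cond_G] nval_gname generic_trees_def)
    then show ?thesis by (metis set_of_elts)
  qed
  ultimately show ?thesis unfolding generic_ext_def using \<tau>(1) by (metis (mono_tags, lifting) mem_Collect_eq)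
qed

lemma finite_in_mono: "finite_in A X \<Longrightarrow> A \<subseteq> B \<Longrightarrow> finite_in B X"
  unfolding finite_in_def by blast

lemma finite_in_VG: "finite B \<Longrightarrow> finite_in VG (enc ` B)"
  by (rule finite_in_mono[OF _ ground_subset]) (auto simp: finite_in_iff)

text \<open>
  Being a finitely splitting tree only asks for enumerations, and these persist to the larger model.
\<close>

lemma fs_tree_VG: "fs_tree V T \<Longrightarrow> fs_tree VG T"
  unfolding fs_tree_def using finite_in_mono[OF _ ground_subset] by blast

lemma adfs_family: "adfs VG (set_of (elts \<T> \<union> generic_trees G))"
proof -
  have el: "elts (set_of (elts \<T> \<union> generic_trees G)) = elts \<T> \<union> generic_trees G"
    by (rule elts_set_of) (simp add: countable_elts generic_trees_def)
  have T: "\<exists>B. elts T = enc ` B \<and> ltree B \<and> (\<forall>l\<in>B. splits B l)" if "T \<in> elts \<T>" for T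
    using adfs_T that fs_tree_obtain unfolding adfs_def by metis
  have gt: "fs_tree V (elts (generic_tree G i))" for i
    unfolding elts_generic_tree fs_tree_enc using ltree_gtree splits_gtree by blast
  have mixed: "finite_in VG (elts (generic_tree G i) \<inter> elts T)" if TT: "T \<in> elts \<T>" for T i
  proof -
    obtain B where B: "elts T = enc ` B" "ltree B" "\<forall>l\<in>B. splits B l" using T[OF TT] by blast
    have "elts (generic_tree G i) \<inter> elts T = enc ` (gtree i \<inter> B)"
      unfolding elts_generic_tree B(1) by auto
    then show ?thesis using finite_in_VG gtree_ground[OF TT B] by simp
  qed
  have gg: "finite_in VG (elts (generic_tree G i) \<inter> elts (generic_tree G j))"
    if "generic_tree G i \<noteq> generic_tree G j" for i j
  proof -
    have "elts (generic_tree G i) \<inter> elts (generic_tree G j) = enc ` (gtree i \<inter> gtree j)"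
      unfolding elts_generic_tree by auto
    moreover have "i \<noteq> j" using that by blast
    ultimately show ?thesis using finite_in_VG gtree_gtree by simp
  qed
  show ?thesis
    unfolding adfs_def el
  proof (intro conjI ballI impI)
    fix T assume "T \<in> elts \<T> \<union> generic_trees G"
    then show "fs_tree VG (elts T)"
      using adfs_T gt fs_tree_VG by (auto simp: adfs_def generic_trees_def)
  next
    fix S T assume S: "S \<in> elts \<T> \<union> generic_trees G" and T: "T \<in> elts \<T> \<union> generic_trees G" and "S \<noteq> T"
    consider "S \<in> elts \<T>" "T \<in> elts \<T>" | i where "S = generic_tree G i" "T \<in> elts \<T>"
      | i where "T = generic_tree G i" "S \<in> elts \<T>" 
      | i j where "S = generic_tree G i" "T = generic_tree G j"
      using S T by (auto simp: generic_trees_def)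
    then show "finite_in VG (elts S \<inter> elts T)"
    proof cases
      case 1
      then show ?thesis using adfs_T \<open>S \<noteq> T\<close> finite_in_mono[OF _ ground_subset] by (auto simp: adfs_def)
    next
      case 2
      then show ?thesis using mixed by blast
    next
      case 3
      then show ?thesis using mixed by (metis Int_commute)
    next
      case 4
      then show ?thesis using gg \<open>S \<noteq> T\<close> by blast
    qed
  qed
qed

end

theorem lemma3p11:
  fixes V G :: "hc set" and \<T> :: hc
  assumes "transitive_model V"
    and "\<T> \<in> V" and "adfs V \<T>"
    and "generic_filter V (tree_forcing V \<T>) forcing_le G"
  shows "set_of (elts \<T> \<union> generic_trees G) \<in> generic_ext V (tree_forcing V \<T>) G \<and>
    adfs (generic_ext V (tree_forcing V \<T>) G) (set_of (elts \<T> \<union> generic_trees G))"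
proof -
  interpret tree_generic V \<T> G
    using assms by unfold_locales
  show ?thesis using family_in_VG adfs_family by blast
qed

end
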